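(* Let $L\mapsto\overline L=f(e^{\sigma}L,\beta)$ be a generalized $\beta$-conformal change. If the vector $$\varphi_i:=L^2e^{\sigma}p\,\sigma_i-(pLe^{\sigma}l_i-q_0\beta\,m_i)\sigma_0+2qF_{0i}-q_0E_{00}m_i$$ vanishes, then $(M,\overline L)$ is of scalar curvature if and only if $(M,L)$ is of scalar curvature.
   Context: $(M,L)$ is an $n$-dimensional smooth Finsler manifold; $\partial_i=\partial/\partial x^i$, $\dot\partial_i=\partial/\partial y^i$, $g_{ij}=\frac12\dot\partial_i\dot\partial_jL^2$, $l_i=\dot\partial_iL$, $y_i=g_{ij}y^j$. The canonical spray is $G^i=\frac12\gamma^i_{jk}y^jy^k$ with $\gamma^i_{jk}=\frac12g^{ir}(\partial_jg_{kr}+\partial_kg_{jr}-\partial_rg_{jk})$; $N^i_j=\dot\partial_jG^i$, $\delta_i=\partial_i-N^r_i\dot\partial_r$, $\Gamma^i_{jk}=\frac12g^{ir}(\delta_jg_{kr}+\delta_kg_{jr}-\delta_rg_{jk})$, and $b_{i|j}=\partial_jb_i-b_m\Gamma^m_{ij}$. A generalized $\beta$-conformal change is $L\mapsto\overline{L}=f(\widetilde L,\beta)$ with $\widetilde L=e^{\sigma(x)}L$, $\sigma$ a smooth function on $M$, $\beta=b_i(x)y^i$ a 1-form, and $f$ smooth and positively homogeneous of degree one in $(\widetilde L,\beta)$; it is assumed that $(M,\overline L)$ is a Finsler space. Subscripts $1,2$ on $f$ denote partial derivatives with respect to $\widetilde L,\beta$. Put $q=ff_2$, $p=ff_1/L$,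 $q_0=ff_{22}$, $m_i=b_i-(\beta/L^2)y_i$, $m^2=g^{ij}m_im_j$, $\sigma_i=\partial_i\sigma$, $\sigma_0=\sigma_iy^i$, $F_{ij}=\frac12(b_{i|j}-b_{j|i})$, $E_{ij}=\frac12(b_{i|j}+b_{j|i})$, $F_{0i}=F_{li}y^l$, $E_{00}=E_{ij}y^iy^j$. Standing assumptions at the points under consideration: $m_i\ne0$, $m^2\neq0$, $p\neq0$, $e^{\sigma}p+m^2q_0\neq0$. "Of scalar curvature" has the standard meaning: the flag curvature at $(x,y)$ is independent of the transversal direction, i.e. it is a scalar function of $(x,y)$ (equivalently, the Riemann curvature of the spray is $R^i_k=\kappa(x,y)(L^2\delta^i_k-y^iy_k)$ for some function $\kappa$). *)

theory Defs
  imports "HOL-Analysis.Analysis"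
begin

section \<open>Smooth functions\<close>

text \<open>All domains below are open; there the following is the usual \<open>C\<^sup>k\<close> and \<open>C\<^sup>\<infinity>\<close>.\<close>

fun Ck_on :: "nat \<Rightarrow> 'a::euclidean_space set \<Rightarrow> ('a \<Rightarrow> 'b::real_normed_vector) \<Rightarrow> bool" where
  "Ck_on 0 S f \<longleftrightarrow> continuous_on S f"
| "Ck_on (Suc k) S f \<longleftrightarrow>
     (\<forall>x\<in>S. f differentiable (at x)) \<and>
     (\<forall>v. Ck_on k S (\<lambda>x. frechet_derivative f (at x) v))"

definition smooth_on :: "'a::euclidean_space set \<Rightarrow> ('a \<Rightarrow> 'b::real_normed_vector) \<Rightarrow> bool" where
  "smooth_on S f \<longleftrightarrow> (\<forall>k. Ck_on k S f)"


section \<open>Smooth manifolds and the tangent bundle\<close>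

text \<open>A chart is a pair of its domain in \<open>M\<close> and its coordinate map; the manifold is the
  topological space \<open>M\<close> with an atlas \<open>A\<close> (which need not be maximal).\<close>

type_synonym ('m, 'n) chart = "'m set \<times> ('m \<Rightarrow> real ^ 'n)"

definition chart_image :: "('m, 'n::finite) chart \<Rightarrow> (real ^ 'n) set" where
  "chart_image c = snd c ` fst c"

definition chart_inv :: "('m, 'n::finite) chart \<Rightarrow> real ^ 'n \<Rightarrow> 'm" where
  "chart_inv c = inv_into (fst c) (snd c)"

definition transition :: "('m, 'n::finite) chart \<Rightarrow> ('m, 'n) chart \<Rightarrow> real ^ 'n \<Rightarrow> real ^ 'n" where
  "transition c d = (\<lambda>x. snd d (chart_inv c x))"

definition chart_of :: "'m topology \<Rightarrow> ('m, 'n::finite) chart \<Rightarrow> bool" where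
  "chart_of M c \<longleftrightarrow>
     openin M (fst c) \<and> open (chart_image c) \<and>
     homeomorphic_map (subtopology M (fst c)) (top_of_set (chart_image c)) (snd c)"

definition smooth_manifold :: "'m topology \<Rightarrow> ('m, 'n::finite) chart set \<Rightarrow> bool" where
  "smooth_manifold M A \<longleftrightarrow>
     Hausdorff_space M \<and> second_countable M \<and>
     (\<forall>c\<in>A. chart_of M c) \<and> topspace M = (\<Union>c\<in>A. fst c) \<and>
     (\<forall>c\<in>A. \<forall>d\<in>A. smooth_on (snd c ` (fst c \<inter> fst d)) (transition c d))"

definition smooth_scalar :: "('m, 'n::finite) chart set \<Rightarrow> ('m \<Rightarrow> real) \<Rightarrow> bool" where
  "smooth_scalar A \<sigma> \<longleftrightarrow> (\<forall>c\<in>A. smooth_on (chart_image c) (\<lambda>x. \<sigma> (chart_inv c x)))"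

text \<open>A tangent vector is a base point together with the components in all charts around that
  point, related by the Jacobians of the transition maps.  Components in other charts
  are set to \<open>0\<close>, so that equal tangent vectors are equal pairs.\<close>

type_synonym ('m, 'n) tvec = "'m \<times> (('m, 'n) chart \<Rightarrow> real ^ 'n)"

definition tangent_bundle :: "'m topology \<Rightarrow> ('m, 'n::finite) chart set \<Rightarrow> ('m, 'n) tvec set" where
  "tangent_bundle M A = {(p, v). p \<in> topspace M \<and>
     (\<forall>c\<in>A. \<forall>d\<in>A. p \<in> fst c \<and> p \<in> fst d \<longrightarrow>
        v d = frechet_derivative (transition c d) (at (snd c p)) (v c)) \<and>
     (\<forall>c. c \<notin> A \<or> p \<notin> fst c \<longrightarrow> v c = 0)}"

definition slit_tangent_bundle ::
    "'m topology \<Rightarrow> ('m, 'n::finite) chart set \<Rightarrow> ('m, 'n) tvec set" where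
  "slit_tangent_bundle M A = {(p, v) \<in> tangent_bundle M A. v \<noteq> (\<lambda>c. 0)}"

definition tscale :: "real \<Rightarrow> ('m, 'n::finite) tvec \<Rightarrow> ('m, 'n) tvec" where
  "tscale t w = (fst w, \<lambda>c. t *\<^sub>R snd w c)"

text \<open>\<open>tvec_of A c (x, y)\<close> is the tangent vector with coordinates \<open>(x\<^sup>i, y\<^sup>i)\<close> in the chart \<open>c\<close>.\<close>

definition tvec_of ::
    "('m, 'n::finite) chart set \<Rightarrow> ('m, 'n) chart \<Rightarrow> (real ^ 'n) \<times> (real ^ 'n) \<Rightarrow> ('m, 'n) tvec" where
  "tvec_of A c z =
     (chart_inv c (fst z),
      \<lambda>d. if d \<in> A \<and> chart_inv c (fst z) \<in> fst d
          then frechet_derivative (transition c d) (at (fst z)) (snd z) else 0)"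

text \<open>Coordinate expressions in the chart \<open>c\<close>: of a subset of the tangent bundle, of a function on
  it, of a function on the manifold, and the components of a 1-form (a fibrewise linear function on
  the tangent bundle).\<close>

definition loc_set ::
    "('m, 'n::finite) chart set \<Rightarrow> ('m, 'n) chart \<Rightarrow> ('m, 'n) tvec set \<Rightarrow> ((real ^ 'n) \<times> (real ^ 'n)) set" where
  "loc_set A c D = {z. fst z \<in> chart_image c \<and> tvec_of A c z \<in> D}"

definition loc_fun ::
    "('m, 'n::finite) chart set \<Rightarrow> ('m, 'n) chart \<Rightarrow> (('m, 'n) tvec \<Rightarrow> real) \<Rightarrow> (real ^ 'n) \<times> (real ^ 'n) \<Rightarrow> real" where
  "loc_fun A c F = (\<lambda>z. F (tvec_of A c z))"

definition loc_scalar :: "('m, 'n::finite) chart \<Rightarrow> ('m \<Rightarrow> real) \<Rightarrow> real ^ 'n \<Rightarrow> real" where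
  "loc_scalar c \<sigma> = (\<lambda>x. \<sigma> (chart_inv c x))"

definition loc_form ::
    "('m, 'n::finite) chart set \<Rightarrow> ('m, 'n) chart \<Rightarrow> (('m, 'n) tvec \<Rightarrow> real) \<Rightarrow> real ^ 'n \<Rightarrow> real ^ 'n" where
  "loc_form A c \<beta> = (\<lambda>x. \<chi> i. \<beta> (tvec_of A c (x, axis i 1)))"

definition smooth_one_form ::
    "('m, 'n::finite) chart set \<Rightarrow> (('m, 'n) tvec \<Rightarrow> real) \<Rightarrow> bool" where
  "smooth_one_form A \<beta> \<longleftrightarrow>
     (\<forall>c\<in>A. smooth_on (chart_image c) (loc_form A c \<beta>) \<and>
        (\<forall>x\<in>chart_image c. \<forall>y. \<beta> (tvec_of A c (x, y)) = (\<Sum>i\<in>UNIV. loc_form A c \<beta> x $ i * y $ i)))"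

definition open_in_tangent_bundle ::
    "('m, 'n::finite) chart set \<Rightarrow> ('m, 'n) tvec set \<Rightarrow> bool" where
  "open_in_tangent_bundle A D \<longleftrightarrow> (\<forall>c\<in>A. open (loc_set A c D))"

text \<open>Domains of Finsler functions; \<open>slit_tangent_bundle M A\<close> is the regular case.  Conic
  subdomains are admitted because functions such as \<open>\<alpha>\<^sup>2 / \<beta>\<close> are only defined on those.\<close>

definition conic_domain ::
    "'m topology \<Rightarrow> ('m, 'n::finite) chart set \<Rightarrow> ('m, 'n) tvec set \<Rightarrow> bool" where
  "conic_domain M A D \<longleftrightarrow>
     D \<subseteq> slit_tangent_bundle M A \<and> open_in_tangent_bundle A D \<and>
     (\<forall>w\<in>D. \<forall>t>0. tscale t w \<in> D)"


section \<open>Finsler geometry in local coordinates\<close>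

text \<open>Here \<open>z = (x, y)\<close> are the coordinates of a tangent vector and \<open>L\<close> is a Finsler function in
  these coordinates; \<open>px\<close> and \<open>py\<close> are \<open>\<partial>/\<partial>x\<^sup>i\<close> and \<open>\<partial>/\<partial>y\<^sup>i\<close>.\<close>

type_synonym 'n lfun = "(real ^ 'n) \<times> (real ^ 'n) \<Rightarrow> real"

definition px :: "'n::finite \<Rightarrow> 'n lfun \<Rightarrow> 'n lfun" where
  "px i F = (\<lambda>z. frechet_derivative F (at z) (axis i 1, 0))"

definition py :: "'n::finite \<Rightarrow> 'n lfun \<Rightarrow> 'n lfun" where
  "py i F = (\<lambda>z. frechet_derivative F (at z) (0, axis i 1))"

definition metric :: "'n::finite lfun \<Rightarrow> (real ^ 'n) \<times> (real ^ 'n) \<Rightarrow> real ^ 'n ^ 'n" where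
  "metric L z = (\<chi> i j. 1/2 * py i (py j (\<lambda>w. (L w)\<^sup>2)) z)"

definition inv_metric :: "'n::finite lfun \<Rightarrow> (real ^ 'n) \<times> (real ^ 'n) \<Rightarrow> real ^ 'n ^ 'n" where
  "inv_metric L z = matrix_inv (metric L z)"

definition supp :: "'n::finite lfun \<Rightarrow> 'n \<Rightarrow> 'n lfun" where
  "supp L i = py i L"

definition y_low :: "'n::finite lfun \<Rightarrow> 'n \<Rightarrow> 'n lfun" where
  "y_low L i z = (\<Sum>j\<in>UNIV. metric L z $ i $ j * snd z $ j)"

definition formal_christoffel :: "'n::finite lfun \<Rightarrow> 'n \<Rightarrow> 'n \<Rightarrow> 'n \<Rightarrow> 'n lfun" where
  "formal_christoffel L i j k z =
     1/2 * (\<Sum>r\<in>UNIV. inv_metric L z $ i $ r *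
        (px j (\<lambda>w. metric L w $ k $ r) z + px k (\<lambda>w. metric L w $ j $ r) z
           - px r (\<lambda>w. metric L w $ j $ k) z))"

definition spray :: "'n::finite lfun \<Rightarrow> 'n \<Rightarrow> 'n lfun" where
  "spray L i z =
     1/2 * (\<Sum>j\<in>UNIV. \<Sum>k\<in>UNIV. formal_christoffel L i j k z * snd z $ j * snd z $ k)"

definition nonlin_conn :: "'n::finite lfun \<Rightarrow> 'n \<Rightarrow> 'n \<Rightarrow> 'n lfun" where
  "nonlin_conn L i j = py j (spray L i)"

definition hor_deriv :: "'n::finite lfun \<Rightarrow> 'n \<Rightarrow> 'n lfun \<Rightarrow> 'n lfun" where
  "hor_deriv L i F z = px i F z - (\<Sum>r\<in>UNIV. nonlin_conn L r i z * py r F z)"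

definition cartan_christoffel :: "'n::finite lfun \<Rightarrow> 'n \<Rightarrow> 'n \<Rightarrow> 'n \<Rightarrow> 'n lfun" where
  "cartan_christoffel L i j k z =
     1/2 * (\<Sum>r\<in>UNIV. inv_metric L z $ i $ r *
        (hor_deriv L j (\<lambda>w. metric L w $ k $ r) z + hor_deriv L k (\<lambda>w. metric L w $ j $ r) z
           - hor_deriv L r (\<lambda>w. metric L w $ j $ k) z))"

text \<open>\<open>R\<^sup>i\<^sub>k\<close> of the spray \<open>y\<^sup>i \<partial>/\<partial>x\<^sup>i - 2 G\<^sup>i \<partial>/\<partial>y\<^sup>i\<close>, in the normalisation in which a Riemannian
  metric of constant sectional curvature \<open>\<kappa>\<close> has \<open>R\<^sup>i\<^sub>k = \<kappa> (L\<^sup>2 \<delta>\<^sup>i\<^sub>k - y\<^sup>i y\<^sub>k)\<close>.\<close>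

definition riemann :: "'n::finite lfun \<Rightarrow> 'n \<Rightarrow> 'n \<Rightarrow> 'n lfun" where
  "riemann L i k z =
     2 * px k (spray L i) z
     - (\<Sum>j\<in>UNIV. snd z $ j * px j (py k (spray L i)) z)
     + 2 * (\<Sum>j\<in>UNIV. spray L j z * py j (py k (spray L i)) z)
     - (\<Sum>j\<in>UNIV. py j (spray L i) z * py k (spray L j) z)"

definition flag_denom :: "'n::finite lfun \<Rightarrow> (real ^ 'n) \<times> (real ^ 'n) \<Rightarrow> real ^ 'n \<Rightarrow> real" where
  "flag_denom L z V =
     (L z)\<^sup>2 * (\<Sum>i\<in>UNIV. \<Sum>j\<in>UNIV. metric L z $ i $ j * V $ i * V $ j)
     - (\<Sum>i\<in>UNIV. y_low L i z * V $ i)\<^sup>2"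

definition flag_curvature :: "'n::finite lfun \<Rightarrow> (real ^ 'n) \<times> (real ^ 'n) \<Rightarrow> real ^ 'n \<Rightarrow> real" where
  "flag_curvature L z V =
     (\<Sum>i\<in>UNIV. \<Sum>j\<in>UNIV. \<Sum>k\<in>UNIV. metric L z $ i $ j * riemann L i k z * V $ k * V $ j)
     / flag_denom L z V"


section \<open>Finsler spaces of scalar curvature\<close>

text \<open>The metric tensor is only required to be nondegenerate, which includes the positive
  definite case.\<close>

definition finsler ::
    "('m, 'n::finite) chart set \<Rightarrow> ('m, 'n) tvec set \<Rightarrow> (('m, 'n) tvec \<Rightarrow> real) \<Rightarrow> bool" where
  "finsler A T L \<longleftrightarrow>
     (\<forall>w\<in>T. L w > 0) \<and>
     (\<forall>w\<in>T. \<forall>t>0. L (tscale t w) = t * L w) \<and>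
     (\<forall>c\<in>A. smooth_on (loc_set A c T) (loc_fun A c L)) \<and>
     (\<forall>c\<in>A. \<forall>z\<in>loc_set A c T. invertible (metric (loc_fun A c L) z))"

text \<open>The transversal directions \<open>V\<close> are those spanning with \<open>y\<close> a nondegenerate plane; for a
  positive definite metric this says precisely that \<open>V\<close> and \<open>y\<close> are linearly independent.\<close>

definition scalar_curvature ::
    "('m, 'n::finite) chart set \<Rightarrow> ('m, 'n) tvec set \<Rightarrow> (('m, 'n) tvec \<Rightarrow> real) \<Rightarrow> bool" where
  "scalar_curvature A D L \<longleftrightarrow>
     (\<forall>c\<in>A. \<forall>z\<in>loc_set A c D. \<forall>V W.
        flag_denom (loc_fun A c L) z V \<noteq> 0 \<longrightarrow> flag_denom (loc_fun A c L) z W \<noteq> 0 \<longrightarrow>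
        flag_curvature (loc_fun A c L) z V = flag_curvature (loc_fun A c L) z W)"


section \<open>Generalized \<open>\<beta>\<close>-conformal changes\<close>

definition change ::
    "(real \<times> real \<Rightarrow> real) \<Rightarrow> ('m \<Rightarrow> real) \<Rightarrow> (('m, 'n::finite) tvec \<Rightarrow> real) \<Rightarrow> (('m, 'n) tvec \<Rightarrow> real)
      \<Rightarrow> ('m, 'n) tvec \<Rightarrow> real" where
  "change f \<sigma> \<beta> L = (\<lambda>w. f (exp (\<sigma> (fst w)) * L w, \<beta> w))"

definition generalized_beta_conformal ::
    "('m, 'n::finite) chart set \<Rightarrow> ('m, 'n) tvec set \<Rightarrow> (real \<times> real) set \<Rightarrow> (real \<times> real \<Rightarrow> real)
      \<Rightarrow> ('m \<Rightarrow> real) \<Rightarrow> (('m, 'n) tvec \<Rightarrow> real) \<Rightarrow> (('m, 'n) tvec \<Rightarrow> real) \<Rightarrow> bool" where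
  "generalized_beta_conformal A T W f \<sigma> \<beta> L \<longleftrightarrow>
     smooth_scalar A \<sigma> \<and> smooth_one_form A \<beta> \<and>
     open W \<and> (\<forall>u v t. (u, v) \<in> W \<longrightarrow> t > 0 \<longrightarrow> (t * u, t * v) \<in> W) \<and>
     smooth_on W f \<and> (\<forall>u v t. (u, v) \<in> W \<longrightarrow> t > 0 \<longrightarrow> f (t * u, t * v) = t * f (u, v)) \<and>
     (\<forall>w\<in>T. (exp (\<sigma> (fst w)) * L w, \<beta> w) \<in> W) \<and>
     finsler A T (change f \<sigma> \<beta> L)"

definition d1 :: "(real \<times> real \<Rightarrow> real) \<Rightarrow> real \<times> real \<Rightarrow> real" where
  "d1 f u = frechet_derivative f (at u) (1, 0)"

definition d2 :: "(real \<times> real \<Rightarrow> real) \<Rightarrow> real \<times> real \<Rightarrow> real" where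
  "d2 f u = frechet_derivative f (at u) (0, 1)"

text \<open>In the rest of this section \<open>L\<close>, \<open>s\<close> and \<open>b\<close> are the coordinate expressions of the Finsler
  function, of \<open>\<sigma>\<close> and of the 1-form.\<close>

definition beta :: "(real ^ 'n \<Rightarrow> real ^ 'n) \<Rightarrow> 'n::finite lfun" where
  "beta b z = (\<Sum>i\<in>UNIV. b (fst z) $ i * snd z $ i)"

definition f_arg :: "(real ^ 'n \<Rightarrow> real) \<Rightarrow> (real ^ 'n \<Rightarrow> real ^ 'n) \<Rightarrow> 'n::finite lfun
      \<Rightarrow> (real ^ 'n) \<times> (real ^ 'n) \<Rightarrow> real \<times> real" where
  "f_arg s b L z = (exp (s (fst z)) * L z, beta b z)"

definition q_coef :: "(real \<times> real \<Rightarrow> real) \<Rightarrow> (real ^ 'n \<Rightarrow> real) \<Rightarrow> (real ^ 'n \<Rightarrow> real ^ 'n)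
      \<Rightarrow> 'n::finite lfun \<Rightarrow> 'n lfun" where
  "q_coef f s b L z = f (f_arg s b L z) * d2 f (f_arg s b L z)"

definition p_coef :: "(real \<times> real \<Rightarrow> real) \<Rightarrow> (real ^ 'n \<Rightarrow> real) \<Rightarrow> (real ^ 'n \<Rightarrow> real ^ 'n)
      \<Rightarrow> 'n::finite lfun \<Rightarrow> 'n lfun" where
  "p_coef f s b L z = f (f_arg s b L z) * d1 f (f_arg s b L z) / L z"

definition q0_coef :: "(real \<times> real \<Rightarrow> real) \<Rightarrow> (real ^ 'n \<Rightarrow> real) \<Rightarrow> (real ^ 'n \<Rightarrow> real ^ 'n)
      \<Rightarrow> 'n::finite lfun \<Rightarrow> 'n lfun" where
  "q0_coef f s b L z = f (f_arg s b L z) * d2 (d2 f) (f_arg s b L z)"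

definition m_cov :: "(real ^ 'n \<Rightarrow> real ^ 'n) \<Rightarrow> 'n::finite lfun \<Rightarrow> 'n \<Rightarrow> 'n lfun" where
  "m_cov b L i z = b (fst z) $ i - beta b z / (L z)\<^sup>2 * y_low L i z"

definition m_sq :: "(real ^ 'n \<Rightarrow> real ^ 'n) \<Rightarrow> 'n::finite lfun \<Rightarrow> 'n lfun" where
  "m_sq b L z = (\<Sum>i\<in>UNIV. \<Sum>j\<in>UNIV. inv_metric L z $ i $ j * m_cov b L i z * m_cov b L j z)"

definition sigma_cov :: "(real ^ 'n \<Rightarrow> real) \<Rightarrow> 'n::finite \<Rightarrow> 'n lfun" where
  "sigma_cov s i = px i (\<lambda>w. s (fst w))"

definition sigma_0 :: "(real ^ 'n \<Rightarrow> real) \<Rightarrow> 'n::finite lfun" where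
  "sigma_0 s z = (\<Sum>i\<in>UNIV. sigma_cov s i z * snd z $ i)"

text \<open>\<open>b_cov b L i j\<close> is \<open>b\<^sub>i\<^sub>|\<^sub>j\<close>: the second index is the direction of differentiation.\<close>

definition b_cov :: "(real ^ 'n \<Rightarrow> real ^ 'n) \<Rightarrow> 'n::finite lfun \<Rightarrow> 'n \<Rightarrow> 'n \<Rightarrow> 'n lfun" where
  "b_cov b L i j z =
     px j (\<lambda>w. b (fst w) $ i) z - (\<Sum>m\<in>UNIV. b (fst z) $ m * cartan_christoffel L m i j z)"

definition F_cov :: "(real ^ 'n \<Rightarrow> real ^ 'n) \<Rightarrow> 'n::finite lfun \<Rightarrow> 'n \<Rightarrow> 'n \<Rightarrow> 'n lfun" where
  "F_cov b L i j z = 1/2 * (b_cov b L i j z - b_cov b L j i z)"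

definition E_cov :: "(real ^ 'n \<Rightarrow> real ^ 'n) \<Rightarrow> 'n::finite lfun \<Rightarrow> 'n \<Rightarrow> 'n \<Rightarrow> 'n lfun" where
  "E_cov b L i j z = 1/2 * (b_cov b L i j z + b_cov b L j i z)"

definition F_0 :: "(real ^ 'n \<Rightarrow> real ^ 'n) \<Rightarrow> 'n::finite lfun \<Rightarrow> 'n \<Rightarrow> 'n lfun" where
  "F_0 b L i z = (\<Sum>l\<in>UNIV. F_cov b L l i z * snd z $ l)"

definition E_00 :: "(real ^ 'n \<Rightarrow> real ^ 'n) \<Rightarrow> 'n::finite lfun \<Rightarrow> 'n lfun" where
  "E_00 b L z = (\<Sum>i\<in>UNIV. \<Sum>j\<in>UNIV. E_cov b L i j z * snd z $ i * snd z $ j)"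

definition phi :: "(real \<times> real \<Rightarrow> real) \<Rightarrow> (real ^ 'n \<Rightarrow> real) \<Rightarrow> (real ^ 'n \<Rightarrow> real ^ 'n)
      \<Rightarrow> 'n::finite lfun \<Rightarrow> 'n \<Rightarrow> 'n lfun" where
  "phi f s b L i z =
     (L z)\<^sup>2 * exp (s (fst z)) * p_coef f s b L z * sigma_cov s i z
     - (p_coef f s b L z * L z * exp (s (fst z)) * supp L i z
          - q0_coef f s b L z * beta b z * m_cov b L i z) * sigma_0 s z
     + 2 * q_coef f s b L z * F_0 b L i z
     - q0_coef f s b L z * E_00 b L z * m_cov b L i z"

definition standing_assumptions :: "(real \<times> real \<Rightarrow> real) \<Rightarrow> (real ^ 'n \<Rightarrow> real)
      \<Rightarrow> (real ^ 'n \<Rightarrow> real ^ 'n) \<Rightarrow> 'n::finite lfun \<Rightarrow> (real ^ 'n) \<times> (real ^ 'n) \<Rightarrow> bool" where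
  "standing_assumptions f s b L z \<longleftrightarrow>
     (\<exists>i. m_cov b L i z \<noteq> 0) \<and> m_sq b L z \<noteq> 0 \<and> p_coef f s b L z \<noteq> 0 \<and>
     exp (s (fst z)) * p_coef f s b L z + m_sq b L z * q0_coef f s b L z \<noteq> 0"

end

theory Submission
  imports Defs
begin

text \<open>The proof shows that vanishing of \<open>\<phi>\<close> makes the canonical sprays of \<open>L\<close> and of its change
  \<open>L'\<close> projectively related, and that being of scalar curvature is a projectively invariant
  property.

  Let \<open>S = y\<^sup>i \<partial>\<^sub>i - 2 G\<^sup>i \<partial>/\<partial>y\<^sup>i\<close> be the canonical spray of \<open>L\<close>.  It is determined by the Euler-Lagrange
  equations \<open>S (\<partial>L\<^sup>2/\<partial>y\<^sup>i) = \<partial>\<^sub>i L\<^sup>2\<close>, and these give \<open>S L = 0\<close> and \<open>S (\<partial>L/\<partial>y\<^sup>i) = \<partial>\<^sub>i L\<close>.  Differentiating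
  \<open>L' = f (e\<^sup>\<sigma> L, \<beta>)\<close> by the chain rule, with Euler's relations for the homogeneous function \<open>f\<close>,
  shows that \<open>\<phi>\<close> measures the failure of \<open>L'\<close> to satisfy the Euler-Lagrange equations along \<open>S\<close>:
  \<open>L' (S (\<partial>L'/\<partial>y\<^sup>i) - \<partial>\<^sub>i L') = - \<phi>\<^sub>i\<close> (lemma \<open>euler_lagrange_defect\<close>).  If \<open>\<phi>\<close> vanishes, this is
  Rapcsak's criterion, and nondegeneracy of the metric of \<open>L'\<close> yields \<open>G' = G + P y\<close> with
  \<open>P = S L' / (2 L')\<close> (lemma \<open>spray_projective\<close>).

  Such a change of the spray adds to the Riemann curvature \<open>R\<^sup>i\<^sub>k\<close> only terms of the form
  \<open>c \<delta>\<^sup>i\<^sub>k + y\<^sup>i \<omega>\<^sub>k\<close> (lemma \<open>jacobi_endo_projective\<close>).  On the other hand, the flag curvature at a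
  point is independent of the transversal direction if and only if \<open>R\<^sup>i\<^sub>k\<close> itself has this form
  (lemma \<open>flag_curvature_independent_iff\<close>).  That equivalence rests on two identities, \<open>y\<^sub>i R\<^sup>i\<^sub>k = 0\<close> and the
  symmetry of \<open>g\<^sub>i\<^sub>j R\<^sup>i\<^sub>k\<close> in \<open>j\<close> and \<open>k\<close>: the flag curvature only sees the quadratic form of \<open>R\<close>, and
  symmetry recovers \<open>R\<close> from it.  Both identities hold because \<open>L\<close> is constant along the horizontal
  distribution, hence annihilated by its curvature.

  Everything except the translation of the index formulas is done without coordinates: on a product
  \<open>V \<times> V\<close> of positions and velocities, the operators above are directional derivatives along a
  vector that may depend on the point, and second derivatives commute.\<close>

section \<open>Directional derivatives and smooth functions\<close>

text \<open>The argument order makes \<open>\<partial> v F\<close> a function again, so that iterated derivatives are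
  \<open>\<partial> u (\<partial> v F)\<close>.\<close>

definition dir_deriv :: "'a::real_normed_vector \<Rightarrow> ('a \<Rightarrow> 'b::real_normed_vector) \<Rightarrow> 'a \<Rightarrow> 'b" ("\<partial>") where
  "\<partial> v F = (\<lambda>z. frechet_derivative F (at z) v)"

lemma dir_deriv_eqI:
  assumes "(F has_derivative F') (at z)"
  shows "\<partial> v F z = F' v"
  using frechet_derivative_at[OF assms] by (simp add: dir_deriv_def)

lemma has_derivative_dir_deriv:
  "F differentiable (at z) \<Longrightarrow> (F has_derivative (\<lambda>v. \<partial> v F z)) (at z)"
  by (simp add: dir_deriv_def frechet_derivative_works[symmetric])

lemma dir_deriv_cong:
  assumes "open U" "z \<in> U" "\<And>w. w \<in> U \<Longrightarrow> F w = G w"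
  shows "\<partial> v F z = \<partial> v G z"
proof (cases "F differentiable (at z)")
  case True
  then show ?thesis
    using frechet_derivative_transform_within_open[OF True assms] by (simp add: dir_deriv_def)
next
  case False
  have "(F has_derivative D) (at z) \<longleftrightarrow> (G has_derivative D) (at z)" for D
    using has_derivative_transform_within_open[of F D z UNIV U G]
      has_derivative_transform_within_open[of G D z UNIV U F] assms by auto
  then show ?thesis by (simp add: dir_deriv_def frechet_derivative_def)
qed

lemma linear_dir_deriv: "F differentiable (at z) \<Longrightarrow> linear (\<lambda>v. \<partial> v F z)"
  by (simp add: dir_deriv_def linear_frechet_derivative)

lemma dir_deriv_basis:
  fixes F :: "'a::euclidean_space \<Rightarrow> 'b::real_normed_vector"
  assumes "F differentiable (at z)"
  shows "\<partial> v F z = (\<Sum>b\<in>Basis. (v \<bullet> b) *\<^sub>R \<partial> b F z)"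
proof -
  interpret linear "\<lambda>v. \<partial> v F z" by (rule linear_dir_deriv[OF assms])
  have "\<partial> v F z = \<partial> (\<Sum>b\<in>Basis. (v \<bullet> b) *\<^sub>R b) F z" by (simp add: euclidean_representation)
  also have "\<dots> = (\<Sum>b\<in>Basis. (v \<bullet> b) *\<^sub>R \<partial> b F z)" by (simp add: sum scale)
  finally show ?thesis .
qed

lemma Ck_on_Suc: "Ck_on (Suc k) S f \<longleftrightarrow> (\<forall>x\<in>S. f differentiable (at x)) \<and> (\<forall>v. Ck_on k S (\<partial> v f))"
  by (simp add: dir_deriv_def)

declare Ck_on.simps(2) [simp del]

lemma Ck_on_cong:
  assumes "open S" "\<And>x. x \<in> S \<Longrightarrow> f x = g x" "Ck_on k S f"
  shows "Ck_on k S g"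
  using assms(2,3)
proof (induction k arbitrary: f g)
  case 0
  then show ?case by (metis Ck_on.simps(1) continuous_on_cong)
next
  case (Suc k)
  have "g differentiable (at x)" if "x \<in> S" for x
  proof -
    have "f differentiable (at x)" using Suc.prems that by (simp add: Ck_on_Suc)
    from has_derivative_transform_within_open[OF has_derivative_dir_deriv[OF this] assms(1) that Suc.prems(1)]
    show ?thesis by (rule differentiableI)
  qed
  moreover have "Ck_on k S (\<partial> v g)" for v
  proof (rule Suc.IH)
    show "\<partial> v f x = \<partial> v g x" if "x \<in> S" for x
      by (rule dir_deriv_cong[OF assms(1) that Suc.prems(1)])
    show "Ck_on k S (\<partial> v f)" using Suc.prems(2) by (simp add: Ck_on_Suc)
  qed
  ultimately show ?case by (simp add: Ck_on_Suc)
qed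

lemma Ck_on_mono: "Ck_on (Suc k) S f \<Longrightarrow> Ck_on k S f"
proof (induction k arbitrary: f)
  case 0
  then show ?case
    by (auto simp: Ck_on_Suc intro!: continuous_at_imp_continuous_on differentiable_imp_continuous_within)
next
  case (Suc k)
  then show ?case by (auto simp: Ck_on_Suc)
qed

lemma Ck_on_const: "Ck_on k S (\<lambda>x. c)"
proof (induction k arbitrary: c)
  case (Suc k)
  have "\<partial> v (\<lambda>x. c) = (\<lambda>x. 0)" for v :: 'a by (auto simp: dir_deriv_def)
  with Suc show ?case by (simp add: Ck_on_Suc)
qed simp

lemma Ck_on_SucI:
  assumes "open S" "\<And>x. x \<in> S \<Longrightarrow> (f has_derivative f' x) (at x)" "\<And>v. Ck_on k S (\<lambda>x. f' x v)"
  shows "Ck_on (Suc k) S f"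
  unfolding Ck_on_Suc
proof (intro conjI ballI allI)
  show "f differentiable (at x)" if "x \<in> S" for x using assms(2)[OF that] by (rule differentiableI)
  show "Ck_on k S (\<partial> v f)" for v
    by (rule Ck_on_cong[OF assms(1) _ assms(3)[of v]]) (rule dir_deriv_eqI[OF assms(2), symmetric])
qed

lemma Ck_on_differentiable: "Ck_on (Suc k) S f \<Longrightarrow> x \<in> S \<Longrightarrow> (f has_derivative (\<lambda>v. \<partial> v f x)) (at x)"
  by (simp add: Ck_on_Suc has_derivative_dir_deriv)

lemma Ck_on_dir_deriv: "Ck_on (Suc k) S f \<Longrightarrow> Ck_on k S (\<partial> v f)"
  by (simp add: Ck_on_Suc)

lemma Ck_on_linear:
  assumes "open S" "bounded_linear h" "Ck_on k S f"
  shows "Ck_on k S (\<lambda>x. h (f x))"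
  using assms(3)
proof (induction k arbitrary: f)
  case 0
  then show ?case using bounded_linear.continuous_on[OF assms(2)] by auto
next
  case (Suc k)
  show ?case
    by (rule Ck_on_SucI[OF assms(1)])
      (rule bounded_linear.has_derivative[OF assms(2)] Ck_on_differentiable Suc Ck_on_dir_deriv | assumption)+
qed

lemma Ck_on_add:
  assumes "open S" "Ck_on k S f" "Ck_on k S g"
  shows "Ck_on k S (\<lambda>x. f x + g x)"
  using assms(2,3)
proof (induction k arbitrary: f g)
  case 0
  then show ?case by (auto intro: continuous_intros)
next
  case (Suc k)
  show ?case
    by (rule Ck_on_SucI[OF assms(1)])
      (rule has_derivative_add Ck_on_differentiable Suc Ck_on_dir_deriv | assumption)+
qed

lemma Ck_on_sum:
  assumes "open S" "\<And>i. i \<in> I \<Longrightarrow> Ck_on k S (f i)"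
  shows "Ck_on k S (\<lambda>x. \<Sum>i\<in>I. f i x)"
  using assms by (induction I rule: infinite_finite_induct) (auto intro: Ck_on_const Ck_on_add)

lemma Ck_on_bilinear:
  assumes "open S" "bounded_bilinear h" "Ck_on k S f" "Ck_on k S g"
  shows "Ck_on k S (\<lambda>x. h (f x) (g x))"
  using assms(3,4)
proof (induction k arbitrary: f g)
  case 0
  then show ?case using bounded_bilinear.continuous_on[OF assms(2)] by auto
next
  case (Suc k)
  show ?case
    by (rule Ck_on_SucI[OF assms(1)])
      (rule bounded_bilinear.FDERIV[OF assms(2)] Ck_on_differentiable Ck_on_add[OF assms(1)] Suc.IH
        Ck_on_mono[OF Suc.prems(1)] Ck_on_mono[OF Suc.prems(2)] Suc.prems Ck_on_dir_deriv | assumption)+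
qed

text \<open>By the chain rule a derivative of the composite is a finite sum over the basis of products of a
  derivative of \<open>h\<close> with \<open>\<partial> b f \<circ> h\<close>, which closes the induction on \<open>k\<close>.\<close>

lemma Ck_on_compose:
  fixes f :: "'b::euclidean_space \<Rightarrow> 'c::real_normed_vector" and h :: "'a::euclidean_space \<Rightarrow> 'b"
  assumes "open S" "open W" "Ck_on k W f" "Ck_on k S h" "h ` S \<subseteq> W"
  shows "Ck_on k S (\<lambda>x. f (h x))"
  using assms(3,4)
proof (induction k arbitrary: f)
  case 0
  then show ?case using assms(5) by (auto intro: continuous_on_compose2)
next
  case (Suc k)
  show ?case
  proof (rule Ck_on_SucI[OF assms(1)])
    fix x assume x: "x \<in> S"
    have 1: "(h has_derivative (\<lambda>v. \<partial> v h x)) (at x)" using Suc.prems x by (simp add: Ck_on_differentiable)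
    have 2: "(f has_derivative (\<lambda>v. \<partial> v f (h x))) (at (h x))"
      using Suc.prems x assms(5) by (auto intro: Ck_on_differentiable)
    have "((\<lambda>x. f (h x)) has_derivative (\<lambda>v. \<partial> (\<partial> v h x) f (h x))) (at x)"
      using has_derivative_compose[OF 1 2] .
    moreover have "\<partial> (\<partial> v h x) f (h x) = (\<Sum>b\<in>Basis. (\<partial> v h x \<bullet> b) *\<^sub>R \<partial> b f (h x))" for v
      using 2 by (intro dir_deriv_basis) (rule differentiableI)
    ultimately show "((\<lambda>x. f (h x)) has_derivative (\<lambda>v. \<Sum>b\<in>Basis. (\<partial> v h x \<bullet> b) *\<^sub>R \<partial> b f (h x))) (at x)"
      by simp
  next
    fix v
    have "Ck_on k S (\<lambda>x. \<partial> b f (h x))" for b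
      using Suc.prems by (intro Suc.IH) (auto intro: Ck_on_mono Ck_on_dir_deriv)
    moreover have "Ck_on k S (\<lambda>x. \<partial> v h x \<bullet> b)" for b
      using Suc.prems
      by (intro Ck_on_linear[OF assms(1) bounded_linear_inner_left]) (auto intro: Ck_on_dir_deriv)
    ultimately show "Ck_on k S (\<lambda>x. \<Sum>b\<in>Basis. (\<partial> v h x \<bullet> b) *\<^sub>R \<partial> b f (h x))"
      by (intro Ck_on_sum[OF assms(1)] Ck_on_bilinear[OF assms(1) bounded_bilinear_scaleR])
  qed
qed

lemma Ck_on_ident: "open S \<Longrightarrow> Ck_on k S (\<lambda>x. x)"
  by (cases k) (auto intro!: Ck_on_SucI[where f' = "\<lambda>x v. v"] Ck_on_const)

lemma Ck_on_exp: "Ck_on k UNIV (exp :: real \<Rightarrow> real)"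
proof (induction k)
  case (Suc k)
  show ?case
    by (rule Ck_on_SucI[where f' = "\<lambda>x v. v * exp x"])
      (auto intro!: derivative_eq_intros Ck_on_bilinear[OF _ bounded_bilinear_mult] Ck_on_const Suc)
qed (simp add: continuous_on_exp continuous_on_id)

lemma Ck_on_inverse: "Ck_on k (- {0}) (inverse :: real \<Rightarrow> real)"
proof (induction k)
  case (Suc k)
  have *: "open (- {0::real})" by auto
  show ?case
  proof (rule Ck_on_SucI[OF *])
    show "(inverse has_derivative (\<lambda>v. (- v) * (inverse x * inverse x))) (at x)" if "x \<in> - {0}" for x :: real
      using that by (auto intro!: derivative_eq_intros)
    show "Ck_on k (- {0}) (\<lambda>x::real. (- v) * (inverse x * inverse x))" for v
      by (intro Ck_on_bilinear[OF * bounded_bilinear_mult] Ck_on_const Suc)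
  qed
qed (auto intro!: continuous_intros)

lemma smooth_on_cong: "open S \<Longrightarrow> (\<And>x. x \<in> S \<Longrightarrow> f x = g x) \<Longrightarrow> smooth_on S f \<Longrightarrow> smooth_on S g"
  by (meson Ck_on_cong smooth_on_def)

lemma Ck_on_subset: "Ck_on k S f \<Longrightarrow> T \<subseteq> S \<Longrightarrow> Ck_on k T f"
  by (induction k arbitrary: f) (auto simp: Ck_on_Suc intro: continuous_on_subset)

lemma smooth_on_subset: "smooth_on S f \<Longrightarrow> T \<subseteq> S \<Longrightarrow> smooth_on T f"
  by (meson Ck_on_subset smooth_on_def)

lemma smooth_on_const: "smooth_on S (\<lambda>x. c)"
  by (simp add: smooth_on_def Ck_on_const)

lemma smooth_on_linear: "open S \<Longrightarrow> bounded_linear h \<Longrightarrow> smooth_on S f \<Longrightarrow> smooth_on S (\<lambda>x. h (f x))"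
  by (simp add: smooth_on_def Ck_on_linear)

lemma smooth_on_bounded_linear: "open S \<Longrightarrow> bounded_linear h \<Longrightarrow> smooth_on S h"
  using smooth_on_linear[of S h "\<lambda>x. x"] by (simp add: smooth_on_def Ck_on_ident)

lemma smooth_on_add: "open S \<Longrightarrow> smooth_on S f \<Longrightarrow> smooth_on S g \<Longrightarrow> smooth_on S (\<lambda>x. f x + g x)"
  by (simp add: smooth_on_def Ck_on_add)

lemma smooth_on_minus: "open S \<Longrightarrow> smooth_on S f \<Longrightarrow> smooth_on S (\<lambda>x. - f x)"
  by (rule smooth_on_linear[OF _ bounded_linear_minus[OF bounded_linear_ident]])

lemma smooth_on_diff: "open S \<Longrightarrow> smooth_on S f \<Longrightarrow> smooth_on S g \<Longrightarrow> smooth_on S (\<lambda>x. f x - g x)"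
  using smooth_on_add[of S f "\<lambda>x. - g x"] by (simp add: smooth_on_minus)

lemma smooth_on_sum: "open S \<Longrightarrow> (\<And>i. i \<in> I \<Longrightarrow> smooth_on S (f i)) \<Longrightarrow> smooth_on S (\<lambda>x. \<Sum>i\<in>I. f i x)"
  by (simp add: smooth_on_def Ck_on_sum)

lemma smooth_on_mult:
  fixes f g :: "'a::euclidean_space \<Rightarrow> real"
  shows "open S \<Longrightarrow> smooth_on S f \<Longrightarrow> smooth_on S g \<Longrightarrow> smooth_on S (\<lambda>x. f x * g x)"
  by (simp add: smooth_on_def Ck_on_bilinear[OF _ bounded_bilinear_mult])

lemma smooth_on_scaleR: "open S \<Longrightarrow> smooth_on S f \<Longrightarrow> smooth_on S g \<Longrightarrow> smooth_on S (\<lambda>x. f x *\<^sub>R g x)"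
  by (simp add: smooth_on_def Ck_on_bilinear[OF _ bounded_bilinear_scaleR])

lemma smooth_on_prod:
  fixes f :: "'i \<Rightarrow> 'a::euclidean_space \<Rightarrow> real"
  shows "open S \<Longrightarrow> (\<And>i. i \<in> I \<Longrightarrow> smooth_on S (f i)) \<Longrightarrow> smooth_on S (\<lambda>x. \<Prod>i\<in>I. f i x)"
  by (induction I rule: infinite_finite_induct) (auto intro: smooth_on_const smooth_on_mult)

lemma smooth_on_compose:
  fixes f :: "'b::euclidean_space \<Rightarrow> 'c::real_normed_vector" and h :: "'a::euclidean_space \<Rightarrow> 'b"
  shows "open S \<Longrightarrow> open W \<Longrightarrow> smooth_on W f \<Longrightarrow> smooth_on S h \<Longrightarrow> h ` S \<subseteq> W \<Longrightarrow> smooth_on S (\<lambda>x. f (h x))"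
  by (simp add: smooth_on_def Ck_on_compose)

lemma smooth_on_exp:
  fixes h :: "'a::euclidean_space \<Rightarrow> real"
  shows "open S \<Longrightarrow> smooth_on S h \<Longrightarrow> smooth_on S (\<lambda>x. exp (h x))"
  using smooth_on_compose[of S UNIV exp h] by (simp add: smooth_on_def Ck_on_exp)

lemma smooth_on_divide:
  fixes g h :: "'a::euclidean_space \<Rightarrow> real"
  assumes "open S" "smooth_on S g" "smooth_on S h" "\<And>x. x \<in> S \<Longrightarrow> h x \<noteq> 0"
  shows "smooth_on S (\<lambda>x. g x / h x)"
proof -
  have "smooth_on S (\<lambda>x. inverse (h x))"
  proof (rule smooth_on_compose[OF assms(1) _ _ assms(3)])
    show "smooth_on (- {0}) (inverse :: real \<Rightarrow> real)" by (simp add: smooth_on_def Ck_on_inverse)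
  qed (use assms(4) in auto)
  then show ?thesis using smooth_on_mult assms by (auto simp: divide_inverse)
qed

lemma smooth_on_vec:
  fixes f :: "'n::finite \<Rightarrow> 'a::euclidean_space \<Rightarrow> real"
  assumes "open S" "\<And>i. smooth_on S (f i)"
  shows "smooth_on S (\<lambda>x. \<chi> i. f i x)"
proof -
  have "(\<lambda>x. \<chi> i. f i x) = (\<lambda>x. \<Sum>i\<in>UNIV. f i x *\<^sub>R axis i 1)"
    by (auto simp: vec_eq_iff axis_def if_distrib cong: if_cong)
  then show ?thesis using assms by (auto intro!: smooth_on_sum smooth_on_scaleR smooth_on_const)
qed

lemma smooth_on_Pair:
  assumes "open S" "smooth_on S f" "smooth_on S g"
  shows "smooth_on S (\<lambda>x. (f x, g x))"
proof -
  have "smooth_on S (\<lambda>x. (f x, 0) + (0, g x))"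
    using assms by (intro smooth_on_add smooth_on_linear[of S "\<lambda>u. (u,0)"] smooth_on_linear[of S "\<lambda>u. (0,u)"])
      (auto intro!: bounded_linear_Pair bounded_linear_ident bounded_linear_zero)
  then show ?thesis by simp
qed

lemma smooth_on_dir_deriv: "smooth_on S f \<Longrightarrow> smooth_on S (\<partial> v f)"
  by (meson Ck_on_dir_deriv smooth_on_def)

lemma smooth_on_differentiable: "smooth_on S f \<Longrightarrow> x \<in> S \<Longrightarrow> f differentiable (at x)"
  by (meson Ck_on_Suc smooth_on_def)

lemma smooth_on_has_derivative: "smooth_on S f \<Longrightarrow> x \<in> S \<Longrightarrow> (f has_derivative (\<lambda>v. \<partial> v f x)) (at x)"
  by (simp add: smooth_on_differentiable has_derivative_dir_deriv)

lemma smooth_on_isCont: "smooth_on S f \<Longrightarrow> x \<in> S \<Longrightarrow> isCont f x"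
  by (simp add: smooth_on_differentiable differentiable_imp_continuous_within)

lemma smooth_on_linear_dir_deriv: "smooth_on S f \<Longrightarrow> x \<in> S \<Longrightarrow> linear (\<lambda>v. \<partial> v f x)"
  by (simp add: smooth_on_differentiable linear_dir_deriv)

text \<open>The product rule for differentiating \<open>F\<close> in a direction \<open>h w\<close> that moves with the point: one
  term freezes the direction and differentiates \<open>F\<close> twice, the other differentiates the direction.
  With it, identities such as \<open>S L = 0\<close> can be differentiated without writing out sums over
  indices.\<close>

lemma has_derivative_along_field:
  fixes F :: "'a::euclidean_space \<Rightarrow> 'b::real_normed_vector"
  assumes "open U" "smooth_on U F" "z \<in> U" "(h has_derivative h') (at z)"
  shows "((\<lambda>w. \<partial> (h w) F w) has_derivative (\<lambda>u. \<partial> u (\<partial> (h z) F) z + \<partial> (h' u) F z)) (at z)"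
proof -
  have basis: "\<partial> v F w = (\<Sum>b\<in>Basis. (v \<bullet> b) *\<^sub>R \<partial> b F w)" if "w \<in> U" for v w
    using assms(2) that by (intro dir_deriv_basis) (rule smooth_on_differentiable)
  have gen: "((\<lambda>w. \<partial> (k w) F w) has_derivative
      (\<lambda>u. (\<Sum>b\<in>Basis. (k z \<bullet> b) *\<^sub>R \<partial> u (\<partial> b F) z + (k' u \<bullet> b) *\<^sub>R \<partial> b F z))) (at z)"
    if k: "(k has_derivative k') (at z)" for k k'
  proof (rule has_derivative_transform_within_open[OF _ assms(1,3)])
    show "((\<lambda>w. \<Sum>b\<in>Basis. (k w \<bullet> b) *\<^sub>R \<partial> b F w) has_derivative
      (\<lambda>u. (\<Sum>b\<in>Basis. (k z \<bullet> b) *\<^sub>R \<partial> u (\<partial> b F) z + (k' u \<bullet> b) *\<^sub>R \<partial> b F z))) (at z)"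
      using assms(2,3) by (intro has_derivative_sum has_derivative_scaleR has_derivative_inner_left k
          smooth_on_has_derivative[of U] smooth_on_dir_deriv)
  qed (simp add: basis)
  have const: "\<partial> u (\<partial> (h z) F) z = (\<Sum>b\<in>Basis. (h z \<bullet> b) *\<^sub>R \<partial> u (\<partial> b F) z)" for u
    using dir_deriv_eqI[OF gen[OF has_derivative_const[of "h z"]]] by simp
  have "(\<Sum>b\<in>Basis. (h z \<bullet> b) *\<^sub>R \<partial> u (\<partial> b F) z + (h' u \<bullet> b) *\<^sub>R \<partial> b F z) =
      \<partial> u (\<partial> (h z) F) z + \<partial> (h' u) F z" for u
    unfolding const basis[OF assms(3), of "h' u"] by (simp add: sum.distrib)
  with gen[OF assms(4)] show ?thesis by simp
qed

lemma smooth_on_along_field: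
  fixes F :: "'a::euclidean_space \<Rightarrow> 'b::real_normed_vector"
  assumes "open U" "smooth_on U F" "smooth_on U h"
  shows "smooth_on U (\<lambda>z. \<partial> (h z) F z)"
proof (rule smooth_on_cong[OF assms(1)])
  show "smooth_on U (\<lambda>z. \<Sum>b\<in>Basis. (h z \<bullet> b) *\<^sub>R \<partial> b F z)"
    using assms by (intro smooth_on_sum smooth_on_scaleR smooth_on_dir_deriv
        smooth_on_linear[OF _ bounded_linear_inner_left])
  show "(\<Sum>b\<in>Basis. (h z \<bullet> b) *\<^sub>R \<partial> b F z) = \<partial> (h z) F z" if "z \<in> U" for z
    using dir_deriv_basis[OF smooth_on_differentiable[OF assms(2) that]] ..
qed

text \<open>The direction \<open>h\<close> is separate from \<open>z\<close> because Finsler functions are homogeneous in the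
  velocity only: there \<open>h = (0, y)\<close>, and \<open>t = 1\<close> is the point \<open>z\<close> itself.\<close>

lemma euler_homogeneous:
  assumes "F differentiable (at z)" "\<And>t. t > 0 \<Longrightarrow> F (z + (t - 1) *\<^sub>R h) = t *\<^sub>R F z"
  shows "\<partial> h F z = F z"
proof -
  have line: "((\<lambda>t. z + (t - 1) *\<^sub>R h) has_derivative (\<lambda>t. t *\<^sub>R h)) (at (1 :: real))"
    by (auto intro!: derivative_eq_intros)
  have "(F has_derivative (\<lambda>v. \<partial> v F z)) (at (z + (1 - 1) *\<^sub>R h))"
    using has_derivative_dir_deriv[OF assms(1)] by simp
  from dir_deriv_eqI[OF has_derivative_compose[OF line this], of 1]
  have "\<partial> 1 (\<lambda>t. F (z + (t - 1) *\<^sub>R h)) (1 :: real) = \<partial> h F z" by simp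
  moreover have "\<partial> 1 (\<lambda>t. F (z + (t - 1) *\<^sub>R h)) (1 :: real) = \<partial> 1 (\<lambda>t. t *\<^sub>R F z) (1 :: real)"
    by (rule dir_deriv_cong[of "{0<..}"]) (auto simp: assms(2))
  moreover have "\<partial> 1 (\<lambda>t. t *\<^sub>R F z) (1 :: real) = F z"
    by (subst dir_deriv_eqI[OF has_derivative_scaleR_left[OF has_derivative_ident]]) simp
  ultimately show ?thesis by simp
qed

text \<open>Two applications of the mean value theorem.  The left side is symmetric in \<open>u\<close> and \<open>v\<close>, the right
  side is a mixed derivative close to \<open>z\<close>; comparing both orders gives Schwarz's theorem in the
  limit.\<close>

lemma dir_deriv_second_difference:
  fixes F :: "'a::euclidean_space \<Rightarrow> real"
  assumes U: "ball z e \<subseteq> U" and F: "smooth_on U F" and h: "h > 0" "h * (norm u + norm v) < e"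
  shows "\<exists>\<xi>. dist z \<xi> \<le> h * (norm u + norm v) \<and>
    F (z + h *\<^sub>R u + h *\<^sub>R v) - F (z + h *\<^sub>R u) - F (z + h *\<^sub>R v) + F z = h * h * \<partial> v (\<partial> u F) \<xi>"
proof -
  have near: "dist z (z + s *\<^sub>R u + t *\<^sub>R v) \<le> h * (norm u + norm v)"
    if "0 \<le> s" "s \<le> h" "0 \<le> t" "t \<le> h" for s t
  proof -
    have "norm (s *\<^sub>R u + t *\<^sub>R v) \<le> s * norm u + t * norm v"
      by (rule norm_triangle_le) (use that in simp)
    also have "\<dots> \<le> h * norm u + h * norm v" using that by (intro add_mono mult_right_mono) auto
    finally show ?thesis by (simp add: dist_norm algebra_simps norm_minus_commute[of _ z] flip: norm_minus_cancel[of "-_-_"])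
  qed
  have in_U: "z + s *\<^sub>R u + t *\<^sub>R v \<in> U" if "0 \<le> s" "s \<le> h" "0 \<le> t" "t \<le> h" for s t
    using near[OF that] h U by auto
  let ?\<phi> = "\<lambda>s. F (z + s *\<^sub>R u + h *\<^sub>R v) - F (z + s *\<^sub>R u)"
  have d: "DERIV (\<lambda>s. F (z + s *\<^sub>R u + t *\<^sub>R v)) s :> \<partial> u F (z + s *\<^sub>R u + t *\<^sub>R v)"
    if "0 \<le> s" "s \<le> h" "0 \<le> t" "t \<le> h" for s t
  proof -
    have "((\<lambda>s. z + s *\<^sub>R u + t *\<^sub>R v) has_derivative (\<lambda>k. k *\<^sub>R u)) (at s)"
      by (auto intro!: derivative_eq_intros)
    from has_derivative_compose[OF this smooth_on_has_derivative[OF F in_U[OF that]]]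
    show ?thesis
      using linear_scale[OF smooth_on_linear_dir_deriv[OF F in_U[OF that]]]
      by (simp add: has_field_derivative_def mult_commute_abs)
  qed
  have d2: "DERIV (\<lambda>t. \<partial> u F (z + s *\<^sub>R u + t *\<^sub>R v)) t :> \<partial> v (\<partial> u F) (z + s *\<^sub>R u + t *\<^sub>R v)"
    if "0 \<le> s" "s \<le> h" "0 \<le> t" "t \<le> h" for s t
  proof -
    have "((\<lambda>t. z + s *\<^sub>R u + t *\<^sub>R v) has_derivative (\<lambda>k. k *\<^sub>R v)) (at t)"
      by (auto intro!: derivative_eq_intros)
    from has_derivative_compose[OF this smooth_on_has_derivative[OF smooth_on_dir_deriv[OF F] in_U[OF that]]]
    show ?thesis
      using linear_scale[OF smooth_on_linear_dir_deriv[OF smooth_on_dir_deriv[OF F] in_U[OF that]]]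
      by (simp add: has_field_derivative_def mult_commute_abs)
  qed
  obtain s where s: "0 < s" "s < h" and "?\<phi> h - ?\<phi> 0 = (h - 0) *
      (\<partial> u F (z + s *\<^sub>R u + h *\<^sub>R v) - \<partial> u F (z + s *\<^sub>R u + 0 *\<^sub>R v))"
    using MVT2[OF h(1), of ?\<phi> "\<lambda>s. \<partial> u F (z + s *\<^sub>R u + h *\<^sub>R v) - \<partial> u F (z + s *\<^sub>R u + 0 *\<^sub>R v)"]
      DERIV_diff[OF d[of _ h] d[of _ 0]] h by auto
  moreover obtain t where t: "0 < t" "t < h" and
    "\<partial> u F (z + s *\<^sub>R u + h *\<^sub>R v) - \<partial> u F (z + s *\<^sub>R u + 0 *\<^sub>R v) = (h - 0) * \<partial> v (\<partial> u F) (z + s *\<^sub>R u + t *\<^sub>R v)"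
    using MVT2[OF h(1) d2[of s]] s by auto
  ultimately show ?thesis using near[of s t] s t by (intro exI[of _ "z + s *\<^sub>R u + t *\<^sub>R v"]) auto
qed

lemma dir_deriv_commute_real:
  fixes F :: "'a::euclidean_space \<Rightarrow> real"
  assumes U: "open U" and F: "smooth_on U F" and z: "z \<in> U"
  shows "\<partial> u (\<partial> v F) z = \<partial> v (\<partial> u F) z"
proof (rule ccontr)
  assume neq: "\<partial> u (\<partial> v F) z \<noteq> \<partial> v (\<partial> u F) z"
  define \<epsilon> where "\<epsilon> = \<bar>\<partial> u (\<partial> v F) z - \<partial> v (\<partial> u F) z\<bar> / 2"
  have \<epsilon>: "\<epsilon> > 0" using neq by (simp add: \<epsilon>_def)
  have cont: "isCont (\<partial> a (\<partial> b F)) z" for a b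
    using F z by (intro smooth_on_isCont[of U] smooth_on_dir_deriv)
  obtain r where r: "r > 0" "ball z r \<subseteq> U" using U z openE by blast
  obtain d1 where d1: "d1 > 0" "\<And>w. dist z w < d1 \<Longrightarrow> \<bar>\<partial> u (\<partial> v F) w - \<partial> u (\<partial> v F) z\<bar> < \<epsilon>"
    using cont[of u v] \<epsilon> unfolding continuous_at_eps_delta by (metis dist_commute dist_real_def)
  obtain d2 where d2: "d2 > 0" "\<And>w. dist z w < d2 \<Longrightarrow> \<bar>\<partial> v (\<partial> u F) w - \<partial> v (\<partial> u F) z\<bar> < \<epsilon>"
    using cont[of v u] \<epsilon> unfolding continuous_at_eps_delta by (metis dist_commute dist_real_def)
  \<comment> \<open>\<open>h\<close> is so small that all corners of the parallelogram lie in the ball where both mixed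
    derivatives differ from their values at \<open>z\<close> by less than \<open>\<epsilon>\<close>\<close>
  define e where "e = min r (min d1 d2)"
  define h where "h = e / (norm u + norm v + 1)"
  have e: "e > 0" using r d1 d2 by (simp add: e_def)
  have h: "h > 0" using e by (simp add: h_def add_nonneg_pos)
  have pos: "norm u + norm v + 1 > 0" by (simp add: add_nonneg_pos)
  have "h * (norm u + norm v) < h * (norm u + norm v + 1)" using h by simp
  also have "\<dots> = e" using pos by (simp add: h_def)
  finally have he: "h * (norm u + norm v) < e" .
  have ball: "ball z e \<subseteq> U" using r by (auto simp: e_def)
  obtain \<xi> where \<xi>: "dist z \<xi> \<le> h * (norm u + norm v)"
    "F (z + h *\<^sub>R u + h *\<^sub>R v) - F (z + h *\<^sub>R u) - F (z + h *\<^sub>R v) + F z = h * h * \<partial> v (\<partial> u F) \<xi>"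
    using dir_deriv_second_difference[OF ball F h he] by blast
  have he': "h * (norm v + norm u) < e" using he by (simp add: add.commute)
  obtain \<eta> where \<eta>: "dist z \<eta> \<le> h * (norm v + norm u)"
    "F (z + h *\<^sub>R v + h *\<^sub>R u) - F (z + h *\<^sub>R v) - F (z + h *\<^sub>R u) + F z = h * h * \<partial> u (\<partial> v F) \<eta>"
    using dir_deriv_second_difference[OF ball F h he'] by blast
  have "h * h * \<partial> v (\<partial> u F) \<xi> = h * h * \<partial> u (\<partial> v F) \<eta>"
    unfolding \<xi>(2)[symmetric] \<eta>(2)[symmetric] by (simp add: add_ac)
  then have eq: "\<partial> v (\<partial> u F) \<xi> = \<partial> u (\<partial> v F) \<eta>" using h by simp
  have "\<bar>\<partial> u (\<partial> v F) \<eta> - \<partial> u (\<partial> v F) z\<bar> < \<epsilon>" using \<eta>(1) he' by (intro d1(2)) (simp add: e_def)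
  moreover have "\<bar>\<partial> v (\<partial> u F) \<xi> - \<partial> v (\<partial> u F) z\<bar> < \<epsilon>" using \<xi>(1) he by (intro d2(2)) (simp add: e_def)
  ultimately show False using eq by (auto simp: \<epsilon>_def abs_if field_simps split: if_splits)
qed

lemma dir_deriv_linear:
  assumes "bounded_linear h" "F differentiable (at z)"
  shows "\<partial> v (\<lambda>w. h (F w)) z = h (\<partial> v F z)"
  by (rule dir_deriv_eqI) (rule bounded_linear.has_derivative[OF assms(1) has_derivative_dir_deriv[OF assms(2)]])

lemma dir_deriv2_linear:
  assumes "open U" "bounded_linear h" "smooth_on U F" "z \<in> U"
  shows "\<partial> u (\<partial> v (\<lambda>w. h (F w))) z = h (\<partial> u (\<partial> v F) z)"
proof -
  have "\<partial> u (\<partial> v (\<lambda>w. h (F w))) z = \<partial> u (\<lambda>w. h (\<partial> v F w)) z"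
    using assms by (intro dir_deriv_cong[of U] dir_deriv_linear) (auto intro: smooth_on_differentiable)
  also have "\<dots> = h (\<partial> u (\<partial> v F) z)"
    using assms by (intro dir_deriv_linear) (auto intro: smooth_on_differentiable smooth_on_dir_deriv)
  finally show ?thesis .
qed

lemma dir_deriv_commute:
  fixes F :: "'a::euclidean_space \<Rightarrow> 'b::euclidean_space"
  assumes U: "open U" and F: "smooth_on U F" and z: "z \<in> U"
  shows "\<partial> u (\<partial> v F) z = \<partial> v (\<partial> u F) z"
proof (rule euclidean_eqI)
  fix b :: 'b
  have bl: "bounded_linear (\<lambda>x. x \<bullet> b)" by (rule bounded_linear_inner_left)
  have "\<partial> u (\<partial> v (\<lambda>w. F w \<bullet> b)) z = \<partial> v (\<partial> u (\<lambda>w. F w \<bullet> b)) z"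
    by (rule dir_deriv_commute_real[OF U smooth_on_linear[OF U bl F] z])
  then show "\<partial> u (\<partial> v F) z \<bullet> b = \<partial> v (\<partial> u F) z \<bullet> b"
    by (simp add: dir_deriv2_linear[OF U bl F z])
qed

section \<open>Sprays and the Jacobi endomorphism\<close>

lemma dir_deriv_linear_simps:
  assumes "smooth_on U F" "z \<in> U"
  shows "\<partial> (a + b) F z = \<partial> a F z + \<partial> b F z" "\<partial> (a - b) F z = \<partial> a F z - \<partial> b F z"
    "\<partial> (- a) F z = - \<partial> a F z" "\<partial> (c *\<^sub>R a) F z = c *\<^sub>R \<partial> a F z" "\<partial> 0 F z = 0"
proof -
  interpret linear "\<lambda>v. \<partial> v F z" by (rule smooth_on_linear_dir_deriv[OF assms])
  show "\<partial> (a + b) F z = \<partial> a F z + \<partial> b F z" "\<partial> (a - b) F z = \<partial> a F z - \<partial> b F z"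
    "\<partial> (- a) F z = - \<partial> a F z" "\<partial> (c *\<^sub>R a) F z = c *\<^sub>R \<partial> a F z" "\<partial> 0 F z = 0"
    by (rule add diff neg scale zero)+
qed

lemma dir_deriv_Pair_simps:
  assumes "smooth_on U F" "z \<in> U"
  shows "\<partial> (a, b) F z = \<partial> (a, 0) F z + \<partial> (0, b) F z"
    "\<partial> (0, a + b) F z = \<partial> (0, a) F z + \<partial> (0, b) F z"
    "\<partial> (0, a - b) F z = \<partial> (0, a) F z - \<partial> (0, b) F z"
    "\<partial> (0, - a) F z = - \<partial> (0, a) F z"
    "\<partial> (0, c *\<^sub>R a) F z = c *\<^sub>R \<partial> (0, a) F z"
  using dir_deriv_linear_simps(1)[OF assms, of "(a, 0)" "(0, b)"]
    dir_deriv_linear_simps(1)[OF assms, of "(0, a)" "(0, b)"]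
    dir_deriv_linear_simps(2)[OF assms, of "(0, a)" "(0, b)"]
    dir_deriv_linear_simps(3)[OF assms, of "(0, a)"]
    dir_deriv_linear_simps(4)[OF assms, of c "(0, a)"]
  by simp_all

lemma dir_deriv2_linear_direction:
  fixes F :: "'a::euclidean_space \<Rightarrow> 'b::euclidean_space"
  assumes "open U" "smooth_on U F" "z \<in> U"
  shows "linear (\<lambda>v. \<partial> u (\<partial> v F) z)"
  unfolding dir_deriv_commute[OF assms, of u]
  by (rule smooth_on_linear_dir_deriv[OF smooth_on_dir_deriv[OF assms(2)] assms(3)])

text \<open>Differentiating Euler's relation for a function of degree \<open>c\<close> in the velocity.  For \<open>u\<close> horizontal
  and constant it says that the derivative again has degree \<open>c\<close>, for \<open>u\<close> vertical that it has degree
  \<open>c - 1\<close>.\<close>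

lemma euler_dir_deriv:
  fixes F :: "'v::euclidean_space \<times> 'v \<Rightarrow> 'b::euclidean_space"
  assumes "open U" "smooth_on U F" "\<And>w. w \<in> U \<Longrightarrow> \<partial> (0, snd w) F w = c *\<^sub>R F w" "z \<in> U"
  shows "\<partial> u (\<partial> (0, snd z) F) z = c *\<^sub>R \<partial> u F z - \<partial> (0, snd u) F z"
proof -
  have "((\<lambda>w. \<partial> (0, snd w) F w) has_derivative
      (\<lambda>u. \<partial> u (\<partial> (0, snd z) F) z + \<partial> (0, snd u) F z)) (at z)"
    using assms by (intro has_derivative_along_field) (auto intro!: derivative_eq_intros)
  then have "\<partial> u (\<lambda>w. \<partial> (0, snd w) F w) z = \<partial> u (\<partial> (0, snd z) F) z + \<partial> (0, snd u) F z"
    by (rule dir_deriv_eqI)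
  moreover have "\<partial> u (\<lambda>w. \<partial> (0, snd w) F w) z = \<partial> u (\<lambda>w. c *\<^sub>R F w) z"
    using assms by (intro dir_deriv_cong)
  moreover have "\<partial> u (\<lambda>w. c *\<^sub>R F w) z = c *\<^sub>R \<partial> u F z"
    using assms by (intro dir_deriv_linear bounded_linear_scaleR_right) (rule smooth_on_differentiable)
  ultimately show ?thesis by (simp add: algebra_simps)
qed

text \<open>The vector \<open>\<delta>\<^sub>v = v\<^sup>i (\<partial>\<^sub>i - N\<^sup>r\<^sub>i \<partial>/\<partial>y\<^sup>r)\<close>, since \<open>\<partial> (0, v) G\<close> is \<open>N v\<close>.\<close>

definition hor_lift :: "('v \<times> 'v \<Rightarrow> 'v) \<Rightarrow> 'v::euclidean_space \<Rightarrow> 'v \<times> 'v \<Rightarrow> 'v \<times> 'v" where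
  "hor_lift G v z = (v, - \<partial> (0, v) G z)"

text \<open>The spray as a vector field on \<open>V \<times> V\<close>: the operator \<open>y\<^sup>i \<partial>\<^sub>i - 2 G\<^sup>i \<partial>/\<partial>y\<^sup>i\<close>.\<close>

definition spray_field :: "('v \<times> 'v \<Rightarrow> 'v) \<Rightarrow> 'v \<times> 'v \<Rightarrow> 'v \<times> 'v::euclidean_space" where
  "spray_field G z = (snd z, - 2 *\<^sub>R G z)"

lemma has_derivative_spray_field:
  assumes "smooth_on U G" "z \<in> U"
  shows "(spray_field G has_derivative (\<lambda>u. (snd u, - 2 *\<^sub>R \<partial> u G z))) (at z)"
  unfolding spray_field_def
  by (auto intro!: derivative_eq_intros smooth_on_has_derivative[OF assms])

text \<open>Up to sign the vertical part of the bracket \<open>[\<delta>\<^sub>v, \<delta>\<^sub>w]\<close> of horizontal fields.\<close>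

definition conn_curvature :: "('v \<times> 'v \<Rightarrow> 'v) \<Rightarrow> 'v::euclidean_space \<Rightarrow> 'v \<Rightarrow> 'v \<times> 'v \<Rightarrow> 'v" where
  "conn_curvature G v w z = \<partial> (hor_lift G v z) (\<partial> (0, w) G) z - \<partial> (hor_lift G w z) (\<partial> (0, v) G) z"

text \<open>The vector \<open>R\<^sup>i\<^sub>k v\<^sup>k\<close>, that is \<open>2 \<partial>\<^sub>k G\<^sup>i - S N\<^sup>i\<^sub>k - N\<^sup>i\<^sub>j N\<^sup>j\<^sub>k\<close> contracted with a constant \<open>v\<close>.\<close>

definition jacobi_endo :: "('v \<times> 'v \<Rightarrow> 'v) \<Rightarrow> 'v::euclidean_space \<Rightarrow> 'v \<times> 'v \<Rightarrow> 'v" where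
  "jacobi_endo G v z =
     2 *\<^sub>R \<partial> (v, 0) G z - \<partial> (spray_field G z) (\<partial> (0, v) G) z - \<partial> (0, \<partial> (0, v) G z) G z"

lemma scaleR_3: "3 *\<^sub>R x = x + x + (x :: 'a::real_vector)"
  using scaleR_left_distrib[of 1 2 x] by (simp add: scaleR_2)

locale spray_on =
  fixes U :: "('v::euclidean_space \<times> 'v) set" and G :: "'v \<times> 'v \<Rightarrow> 'v"
  assumes open_U: "open U"
    and smooth_G: "smooth_on U G"
    and euler_G: "\<And>z. z \<in> U \<Longrightarrow> \<partial> (0, snd z) G z = 2 *\<^sub>R G z"
begin

lemmas smooth_dG = smooth_on_dir_deriv[OF smooth_G]

lemma euler_dG: "z \<in> U \<Longrightarrow> \<partial> u (\<partial> (0, snd z) G) z = 2 *\<^sub>R \<partial> u G z - \<partial> (0, snd u) G z"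
  using euler_dir_deriv[OF open_U smooth_G euler_G] by simp

text \<open>The nonlinear connection is homogeneous of degree one.\<close>

lemma euler_dG_vert: "z \<in> U \<Longrightarrow> \<partial> (0, snd z) (\<partial> (0, v) G) z = \<partial> (0, v) G z"
  unfolding dir_deriv_commute[OF open_U smooth_G, of z "(0, snd z)"] euler_dG
  by (simp add: scaleR_2)

text \<open>At \<open>v = y\<close> the horizontal lift is the spray field, because \<open>N y = 2 G\<close>.\<close>

lemma conn_curvature_contract:
  assumes z: "z \<in> U"
  shows "conn_curvature G (snd z) w z = - jacobi_endo G w z"
proof -
  have 1: "hor_lift G (snd z) z = spray_field G z"
    by (simp add: hor_lift_def spray_field_def euler_G[OF z])
  have 2: "\<partial> (hor_lift G w z) (\<partial> (0, snd z) G) z = 2 *\<^sub>R \<partial> (w, 0) G z - \<partial> (0, \<partial> (0, w) G z) G z"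
    unfolding euler_dG[OF z] hor_lift_def
    by (subst dir_deriv_Pair_simps(1)[OF smooth_G z])
      (simp add: dir_deriv_Pair_simps(4)[OF smooth_G z] scaleR_2 algebra_simps)
  show ?thesis unfolding conn_curvature_def 1 2 jacobi_endo_def by simp
qed

lemma has_derivative_jacobi_endo:
  assumes z: "z \<in> U"
  shows "(jacobi_endo G v has_derivative (\<lambda>u. 2 *\<^sub>R \<partial> u (\<partial> (v, 0) G) z
    - (\<partial> u (\<partial> (spray_field G z) (\<partial> (0, v) G)) z + \<partial> (snd u, - 2 *\<^sub>R \<partial> u G z) (\<partial> (0, v) G) z)
    - (\<partial> u (\<partial> (0, \<partial> (0, v) G z) G) z + \<partial> (0, \<partial> u (\<partial> (0, v) G) z) G z))) (at z)"
  unfolding jacobi_endo_def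
  by (intro has_derivative_diff has_derivative_scaleR_right has_derivative_along_field[OF open_U]
      smooth_dG smooth_G z has_derivative_Pair has_derivative_const has_derivative_spray_field[OF smooth_G]
      smooth_on_has_derivative[OF smooth_dG z])

text \<open>The curvature of the connection is recovered from the Jacobi endomorphism by antisymmetrised
  vertical differentiation.  The third derivatives of \<open>G\<close> are symmetric in \<open>v\<close> and \<open>w\<close> and cancel;
  the remaining mixed and vertical second derivatives add up to three times those in the curvature.\<close>

lemma jacobi_endo_vertical_curl:
  assumes z: "z \<in> U"
  shows "\<partial> (0, w) (jacobi_endo G v) z - \<partial> (0, v) (jacobi_endo G w) z = 3 *\<^sub>R conn_curvature G v w z"
proof -
  note comm = dir_deriv_commute[OF open_U smooth_G]
  have third: "\<partial> (0, w) (\<partial> c (\<partial> (0, v) G)) z = \<partial> (0, v) (\<partial> c (\<partial> (0, w) G)) z" for c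
  proof -
    have "\<partial> (0, w) (\<partial> c (\<partial> (0, v) G)) z = \<partial> c (\<partial> (0, w) (\<partial> (0, v) G)) z"
      by (rule dir_deriv_commute[OF open_U smooth_dG z])
    also have "\<dots> = \<partial> c (\<partial> (0, v) (\<partial> (0, w) G)) z"
      by (rule dir_deriv_cong[OF open_U z]) (rule comm)
    also have "\<dots> = \<partial> (0, v) (\<partial> c (\<partial> (0, w) G)) z"
      by (rule dir_deriv_commute[OF open_U smooth_dG z])
    finally show ?thesis .
  qed
  have split: "\<partial> (a, - c *\<^sub>R b) (\<partial> (0, u) G) z = \<partial> (a, 0) (\<partial> (0, u) G) z - c *\<^sub>R \<partial> (0, b) (\<partial> (0, u) G) z" for a b c u
    by (subst dir_deriv_Pair_simps(1)[OF smooth_dG z])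
      (simp add: dir_deriv_Pair_simps(3-)[OF smooth_dG z])
  have split1: "\<partial> (a, - b) (\<partial> (0, u) G) z = \<partial> (a, 0) (\<partial> (0, u) G) z - \<partial> (0, b) (\<partial> (0, u) G) z" for a b u
    using split[of a 1 b u] by simp
  \<comment> \<open>after the cancellation of third derivatives only the blocks \<open>A\<close> (mixed) and \<open>B\<close> (vertical) of the
    second derivative remain, and \<open>B\<close> is symmetric\<close>
  define A where "A a b = \<partial> (a, 0) (\<partial> (0, b) G) z" for a b
  define B where "B a b = \<partial> (0, a) (\<partial> (0, b) G) z" for a b
  have B: "B a b = B b a" for a b unfolding B_def by (rule comm[OF z])
  have A': "\<partial> (0, b) (\<partial> (a, 0) G) z = A a b" for a b unfolding A_def by (rule comm[OF z])
  have B_scale: "B (c *\<^sub>R a) b = c *\<^sub>R B a b" for a b c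
    unfolding B_def by (rule dir_deriv_Pair_simps(5)[OF smooth_dG z])
  let ?N = "\<lambda>v. \<partial> (0, v) G z"
  have J: "\<partial> (0, a) (jacobi_endo G b) z = 2 *\<^sub>R A b a
      - (\<partial> (0, a) (\<partial> (spray_field G z) (\<partial> (0, b) G)) z + A a b - 2 *\<^sub>R B (?N a) b)
      - (B (?N b) a + \<partial> (0, B a b) G z)" for a b
    by (subst dir_deriv_eqI[OF has_derivative_jacobi_endo[OF z]])
      (simp add: split1 B_scale A' B[of a "?N b"] flip: A_def B_def)
  have C: "conn_curvature G v w z = A v w - B (?N v) w - (A w v - B (?N w) v)"
    by (simp add: conn_curvature_def hor_lift_def split1 A_def B_def)
  show ?thesis
    unfolding J C third[of "spray_field G z"] B[of v w] by (simp add: scaleR_2 scaleR_3 algebra_simps)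
qed

end

text \<open>The energy \<open>E\<close> plays the role of \<open>L\<^sup>2\<close>.  Its vertical Hessian is twice the fundamental tensor.\<close>

locale metric_spray = spray_on U G for U :: "('v::euclidean_space \<times> 'v) set" and G +
  fixes E :: "'v \<times> 'v \<Rightarrow> real"
  assumes smooth_E: "smooth_on U E"
    and euler_E: "\<And>z. z \<in> U \<Longrightarrow> \<partial> (0, snd z) E z = 2 * E z"
    and euler_lagrange: "\<And>z v. z \<in> U \<Longrightarrow> \<partial> (spray_field G z) (\<partial> (0, v) E) z = \<partial> (v, 0) E z"
begin

lemma euler_dE: "z \<in> U \<Longrightarrow> \<partial> u (\<partial> (0, snd z) E) z = 2 * \<partial> u E z - \<partial> (0, snd u) E z"
  using euler_dir_deriv[OF open_U smooth_E, of 2] euler_E by simp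

text \<open>Conservation of energy: contract the Euler-Lagrange equations with \<open>y\<close> and use that \<open>E\<close> has
  degree two.\<close>

lemma energy_constant_along_spray:
  assumes z: "z \<in> U"
  shows "\<partial> (spray_field G z) E z = 0"
proof -
  have "\<partial> (spray_field G z) (\<partial> (0, snd z) E) z = \<partial> (snd z, 0) E z" by (rule euler_lagrange[OF z])
  moreover have "\<partial> (spray_field G z) E z = \<partial> (snd z, 0) E z + \<partial> (0, - 2 *\<^sub>R G z) E z"
    unfolding spray_field_def by (rule dir_deriv_Pair_simps(1)[OF smooth_E z])
  ultimately show ?thesis unfolding euler_dE[OF z] by (simp add: spray_field_def)
qed

text \<open>Differentiate \<open>S E = 0\<close> in the vertical direction \<open>v\<close>; the Euler-Lagrange equations turn the second
  derivative of \<open>E\<close> into \<open>\<partial> (v, 0) E\<close>, and the result is twice the claim.\<close>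

lemma energy_constant_along_hor_lift:
  assumes z: "z \<in> U"
  shows "\<partial> (hor_lift G v z) E z = 0"
proof -
  have "\<partial> (0, v) (\<lambda>w. \<partial> (spray_field G w) E w) z = \<partial> (0, v) (\<lambda>w. 0) z"
    by (rule dir_deriv_cong[OF open_U z]) (rule energy_constant_along_spray)
  then have "\<partial> (0, v) (\<partial> (spray_field G z) E) z + \<partial> (v, - 2 *\<^sub>R \<partial> (0, v) G z) E z = 0"
    by (subst (asm) dir_deriv_eqI[OF has_derivative_along_field[OF open_U smooth_E z has_derivative_spray_field[OF smooth_G z]]])
      (simp add: dir_deriv_eqI[OF has_derivative_const])
  then have "\<partial> (v, 0) E z + \<partial> (v, - 2 *\<^sub>R \<partial> (0, v) G z) E z = 0"
    unfolding dir_deriv_commute[OF open_U smooth_E z, of "(0, v)"] euler_lagrange[OF z] .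
  then show ?thesis
    unfolding hor_lift_def dir_deriv_Pair_simps(1)[OF smooth_E z, of v "- _"]
    by (simp add: dir_deriv_Pair_simps(3-)[OF smooth_E z] dir_deriv_Pair_simps(1)[OF smooth_E z, of v "- _"])
qed

lemma has_derivative_hor_lift:
  assumes z: "z \<in> U"
  shows "(hor_lift G v has_derivative (\<lambda>u. (0, - \<partial> u (\<partial> (0, v) G) z))) (at z)"
  unfolding hor_lift_def
  by (intro has_derivative_Pair has_derivative_const has_derivative_minus smooth_on_has_derivative[OF smooth_dG z])

text \<open>A function constant along all horizontal fields is annihilated by their brackets.\<close>

lemma energy_conn_curvature:
  assumes z: "z \<in> U"
  shows "\<partial> (0, conn_curvature G v w z) E z = 0"
proof -
  have *: "\<partial> u (\<partial> (hor_lift G v z) E) z = \<partial> (0, \<partial> u (\<partial> (0, v) G) z) E z" for u v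
  proof -
    have "\<partial> u (\<lambda>w. \<partial> (hor_lift G v w) E w) z = \<partial> u (\<lambda>w. 0) z"
      by (rule dir_deriv_cong[OF open_U z]) (rule energy_constant_along_hor_lift)
    then show ?thesis
      by (subst (asm) dir_deriv_eqI[OF has_derivative_along_field[OF open_U smooth_E z has_derivative_hor_lift[OF z]]])
        (simp add: dir_deriv_eqI[OF has_derivative_const] dir_deriv_Pair_simps(4)[OF smooth_E z])
  qed
  show ?thesis
    unfolding conn_curvature_def dir_deriv_Pair_simps(3)[OF smooth_E z] *[symmetric]
    using dir_deriv_commute[OF open_U smooth_E z] by simp
qed

text \<open>The identity \<open>y\<^sub>i R\<^sup>i\<^sub>k = 0\<close>.\<close>

lemma energy_jacobi_endo:
  assumes z: "z \<in> U"
  shows "\<partial> (0, jacobi_endo G w z) E z = 0"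
  using energy_conn_curvature[OF z, of "snd z" w]
  by (simp add: conn_curvature_contract[OF z] dir_deriv_Pair_simps(4)[OF smooth_E z])

text \<open>Differentiating \<open>y\<^sub>i R\<^sup>i\<^sub>k = 0\<close> vertically expresses \<open>g\<^sub>i\<^sub>j R\<^sup>i\<^sub>k\<close> by vertical derivatives of \<open>R\<close>,
  whose antisymmetric part is three times the curvature of the connection and is annihilated by
  the energy.\<close>

lemma jacobi_endo_symmetric:
  assumes z: "z \<in> U"
  shows "\<partial> (0, v) (\<partial> (0, jacobi_endo G w z) E) z = \<partial> (0, w) (\<partial> (0, jacobi_endo G v z) E) z"
proof -
  have *: "\<partial> (0, a) (\<partial> (0, jacobi_endo G b z) E) z = - \<partial> (0, \<partial> (0, a) (jacobi_endo G b) z) E z" for a b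
  proof -
    have 1: "(jacobi_endo G b has_derivative (\<lambda>u. \<partial> u (jacobi_endo G b) z)) (at z)"
      using has_derivative_jacobi_endo[OF z] by (intro has_derivative_dir_deriv differentiableI)
    have "\<partial> (0, a) (\<lambda>w. \<partial> (0, jacobi_endo G b w) E w) z = \<partial> (0, a) (\<lambda>w. 0) z"
      by (rule dir_deriv_cong[OF open_U z]) (rule energy_jacobi_endo)
    then show ?thesis
      by (subst (asm) dir_deriv_eqI[OF has_derivative_along_field[OF open_U smooth_E z has_derivative_Pair[OF has_derivative_const 1]]])
        (simp add: dir_deriv_eqI[OF has_derivative_const])
  qed
  have "\<partial> (0, \<partial> (0, v) (jacobi_endo G w) z - \<partial> (0, w) (jacobi_endo G v) z) E z = 0"
    unfolding jacobi_endo_vertical_curl[OF z]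
    by (simp add: dir_deriv_Pair_simps(5)[OF smooth_E z] energy_conn_curvature[OF z])
  then show ?thesis unfolding * dir_deriv_Pair_simps(3)[OF smooth_E z] by simp
qed

lemma linear_jacobi_endo:
  assumes z: "z \<in> U"
  shows "linear (\<lambda>v. jacobi_endo G v z)"
proof -
  have pair: "(a + b, 0) = (a, 0) + (b, 0 :: 'v)" "(c *\<^sub>R a, 0) = c *\<^sub>R (a, 0 :: 'v)"
    "(0, a + b) = (0, a) + (0 :: 'v, b)" "(0, c *\<^sub>R a) = c *\<^sub>R (0 :: 'v, a)" for a b :: 'v and c
    by simp_all
  note second = dir_deriv2_linear_direction[OF open_U smooth_G z]
  show ?thesis
    by (rule linearI)
      (simp_all only: jacobi_endo_def pair dir_deriv_linear_simps[OF smooth_G z] linear_add[OF second] linear_scale[OF second],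
       simp_all add: algebra_simps scaleR_left_commute)
qed

end

text \<open>In the expansion of the curvature of \<open>G + P y\<close> the multiples of \<open>G\<close> and of \<open>N v\<close>, whose coefficients
  come from \<open>P\<close>, cancel by homogeneity; the other new terms are multiples of \<open>v\<close> or of \<open>y\<close>.\<close>

lemma jacobi_endo_projective:
  fixes G H :: "'v::euclidean_space \<times> 'v \<Rightarrow> 'v"
  assumes G: "spray_on U G" and P: "smooth_on U P" and euler_P: "\<And>z. z \<in> U \<Longrightarrow> \<partial> (0, snd z) P z = P z"
    and H: "\<And>z. z \<in> U \<Longrightarrow> H z = G z + P z *\<^sub>R snd z" and z: "z \<in> U"
  shows "\<exists>c \<omega>. \<forall>v. jacobi_endo H v z = jacobi_endo G v z + c *\<^sub>R v + \<omega> v *\<^sub>R snd z"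
proof -
  interpret spray_on U G by fact
  note smooth_dP = smooth_on_dir_deriv[OF P]
  have dH: "\<partial> u H w = \<partial> u G w + \<partial> u P w *\<^sub>R snd w + P w *\<^sub>R snd u" if w: "w \<in> U" for u w
  proof -
    have "((\<lambda>w. G w + P w *\<^sub>R snd w) has_derivative (\<lambda>u. \<partial> u G w + (\<partial> u P w *\<^sub>R snd w + P w *\<^sub>R snd u))) (at w)"
      by (auto intro!: derivative_eq_intros smooth_on_has_derivative[OF smooth_G w] smooth_on_has_derivative[OF P w])
    from dir_deriv_eqI[OF this] show ?thesis
      by (subst dir_deriv_cong[OF open_U w H]) auto
  qed
  have d2H: "\<partial> u (\<partial> (0, v) H) z = \<partial> u (\<partial> (0, v) G) z + \<partial> u (\<partial> (0, v) P) z *\<^sub>R snd z + \<partial> (0, v) P z *\<^sub>R snd u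
      + \<partial> u P z *\<^sub>R v" for u v
  proof -
    have "((\<lambda>w. \<partial> (0, v) G w + \<partial> (0, v) P w *\<^sub>R snd w + P w *\<^sub>R v) has_derivative 
       (\<lambda>u. \<partial> u (\<partial> (0, v) G) z + (\<partial> u (\<partial> (0, v) P) z *\<^sub>R snd z + \<partial> (0, v) P z *\<^sub>R snd u) + \<partial> u P z *\<^sub>R v)) (at z)"
      by (auto intro!: derivative_eq_intros smooth_on_has_derivative[OF smooth_dG z]
          smooth_on_has_derivative[OF P z] smooth_on_has_derivative[OF smooth_dP z])
    from dir_deriv_eqI[OF this] show ?thesis
      by (subst dir_deriv_cong[OF open_U z dH]) auto
  qed
  have field: "spray_field H z = spray_field G z - (2 * P z) *\<^sub>R (0, snd z)"
    by (simp add: spray_field_def H[OF z] algebra_simps)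
  define S where "S = \<partial> (spray_field G z) P z"
  have dP: "\<partial> (0, snd z) (\<partial> (0, v) P) z = 0" for v
    unfolding dir_deriv_commute[OF open_U P z, of "(0, snd z)"]
    using euler_dir_deriv[OF open_U P, of 1] euler_P z by simp
  have formula: "jacobi_endo H v z = jacobi_endo G v z + ((P z)\<^sup>2 - S) *\<^sub>R v + (2 * \<partial> (v, 0) P z
      - \<partial> (spray_field G z) (\<partial> (0, v) P) z - \<partial> (0, \<partial> (0, v) G z) P z - P z * \<partial> (0, v) P z) *\<^sub>R snd z" for v
  proof -
    define N where "N = \<partial> (0, v) G z"
    define p where "p = \<partial> (0, v) P z"
    have NH: "\<partial> (0, v) H z = N + p *\<^sub>R snd z + P z *\<^sub>R v"
      by (simp add: dH[OF z] N_def p_def)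
    have 1: "\<partial> (v, 0) H z = \<partial> (v, 0) G z + \<partial> (v, 0) P z *\<^sub>R snd z"
      by (simp add: dH[OF z])
    have 2: "\<partial> (spray_field H z) (\<partial> (0, v) H) z = \<partial> (spray_field G z) (\<partial> (0, v) G) z - (2 * P z) *\<^sub>R N
        + \<partial> (spray_field G z) (\<partial> (0, v) P) z *\<^sub>R snd z + p *\<^sub>R (- 2 *\<^sub>R (G z + P z *\<^sub>R snd z))
        + (S - 2 * P z * P z) *\<^sub>R v"
    proof -
      have "snd (spray_field H z) = - 2 *\<^sub>R (G z + P z *\<^sub>R snd z)"
        by (simp add: spray_field_def H[OF z])
      moreover have "\<partial> (spray_field H z) (\<partial> (0, v) G) z = \<partial> (spray_field G z) (\<partial> (0, v) G) z - (2 * P z) *\<^sub>R N"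
        unfolding field dir_deriv_linear_simps[OF smooth_dG z] euler_dG_vert[OF z] N_def ..
      moreover have "\<partial> (spray_field H z) (\<partial> (0, v) P) z = \<partial> (spray_field G z) (\<partial> (0, v) P) z"
        unfolding field dir_deriv_linear_simps[OF smooth_dP z] dP by simp
      moreover have "\<partial> (spray_field H z) P z = S - 2 * P z * P z"
        unfolding field dir_deriv_linear_simps[OF P z] euler_P[OF z] by (simp add: S_def)
      ultimately show ?thesis unfolding d2H by (simp add: p_def)
    qed
    have 3: "\<partial> (0, N + p *\<^sub>R snd z + P z *\<^sub>R v) H z = \<partial> (0, N) G z + p *\<^sub>R (2 *\<^sub>R G z) + P z *\<^sub>R N
       + (\<partial> (0, N) P z + 2 * p * P z) *\<^sub>R snd z + P z *\<^sub>R (N + p *\<^sub>R snd z + P z *\<^sub>R v)"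
      unfolding dH[OF z] dir_deriv_Pair_simps(2,5)[OF smooth_G z] dir_deriv_Pair_simps(2,5)[OF P z]
        euler_G[OF z] euler_P[OF z]
      by (simp add: N_def p_def)
    have "jacobi_endo H v z = 2 *\<^sub>R (\<partial> (v, 0) G z + \<partial> (v, 0) P z *\<^sub>R snd z)
      - (\<partial> (spray_field G z) (\<partial> (0, v) G) z - (2 * P z) *\<^sub>R N
        + \<partial> (spray_field G z) (\<partial> (0, v) P) z *\<^sub>R snd z + p *\<^sub>R (- 2 *\<^sub>R (G z + P z *\<^sub>R snd z))
        + (S - 2 * P z * P z) *\<^sub>R v)
      - (\<partial> (0, N) G z + p *\<^sub>R (2 *\<^sub>R G z) + P z *\<^sub>R N
       + (\<partial> (0, N) P z + 2 * p * P z) *\<^sub>R snd z + P z *\<^sub>R (N + p *\<^sub>R snd z + P z *\<^sub>R v))"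
      unfolding jacobi_endo_def NH 1 2 3 ..
    also have "\<dots> = 2 *\<^sub>R \<partial> (v, 0) G z - \<partial> (spray_field G z) (\<partial> (0, v) G) z - \<partial> (0, N) G z
      + ((P z)\<^sup>2 - S) *\<^sub>R v + (2 * \<partial> (v, 0) P z
      - \<partial> (spray_field G z) (\<partial> (0, v) P) z - \<partial> (0, N) P z - P z * p) *\<^sub>R snd z"
      by (simp add: algebra_simps scaleR_2 power2_eq_square scaleR_left_commute flip: scaleR_scaleR)
    finally show ?thesis by (simp add: jacobi_endo_def N_def p_def)
  qed
  show ?thesis by (intro exI allI) (rule formula)
qed

section \<open>Quadratic forms of constant sectional quotient\<close>

text \<open>The values at \<open>0, 1, -1, 2\<close> determine a cubic.\<close>

lemma cubic_coefficients_zero: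
  fixes c0 c1 c2 c3 :: real
  assumes "\<And>t. c0 + c1 * t + c2 * t\<^sup>2 + c3 * t ^ 3 = 0"
  shows "c3 = 0 \<and> c2 = 0"
  using assms[of 0] assms[of 1] assms[of "-1"] assms[of 2] by simp

text \<open>The pointwise algebra behind scalar curvature.  If the quotient of the two quadratic forms is
  constant \<open>k\<close> wherever it is defined, then \<open>Q v v = g (R v) v - k * den v\<close> satisfies
  \<open>Q v v * den v = 0\<close> everywhere.  Along a line in a direction \<open>u\<close> with \<open>den u \<noteq> 0\<close> the product is a
  cubic polynomial (as \<open>Q u u = 0\<close>), and its vanishing forces \<open>Q v v = 0\<close>.  Polarisation, which uses
  that \<open>R\<close> is self-adjoint, and nondegeneracy then determine \<open>R\<close>.  If \<open>den\<close> vanishes identically,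
  \<open>g\<close> has rank one and \<open>g (R v) v = 0\<close> because \<open>R\<close> takes values orthogonal to \<open>y\<close>.  Conversely, that
  orthogonality determines \<open>\<omega>\<close> as \<open>- c g(y, v) / g(y, y)\<close>.\<close>

lemma sectional_quotient_constant_iff:
  fixes g :: "'v::euclidean_space \<Rightarrow> 'v \<Rightarrow> real" and R :: "'v \<Rightarrow> 'v"
  assumes g: "bilinear g" and g_sym: "\<And>a b. g a b = g b a"
    and nondeg: "\<And>b. (\<And>a. g a b = 0) \<Longrightarrow> b = 0"
    and R: "linear R" and R_sym: "\<And>a b. g (R a) b = g (R b) a" and R_y: "\<And>a. g y (R a) = 0"
    and y: "g y y \<noteq> 0"
  defines "den \<equiv> \<lambda>v. g y y * g v v - (g y v)\<^sup>2"
  shows "(\<forall>v w. den v \<noteq> 0 \<longrightarrow> den w \<noteq> 0 \<longrightarrow> g (R v) v / den v = g (R w) w / den w) \<longleftrightarrow>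
    (\<exists>c \<omega>. \<forall>v. R v = c *\<^sub>R v + \<omega> v *\<^sub>R y)"
proof
  note lin = bilinear_ladd[OF g] bilinear_radd[OF g] bilinear_lmul[OF g] bilinear_rmul[OF g]
    bilinear_lsub[OF g] bilinear_rsub[OF g]
  {
    assume "\<exists>c \<omega>. \<forall>v. R v = c *\<^sub>R v + \<omega> v *\<^sub>R y"
    then obtain c \<omega> where eq: "\<And>v. R v = c *\<^sub>R v + \<omega> v *\<^sub>R y" by blast
    have \<omega>: "\<omega> v = - c * g y v / g y y" for v
      using R_y[of v] y by (simp add: eq lin field_simps)
    have "g (R v) v = c / g y y * den v" for v
      using y by (simp add: eq lin \<omega> den_def power2_eq_square field_simps)
    then show "\<forall>v w. den v \<noteq> 0 \<longrightarrow> den w \<noteq> 0 \<longrightarrow> g (R v) v / den v = g (R w) w / den w" by simp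
  }
  assume indep: "\<forall>v w. den v \<noteq> 0 \<longrightarrow> den w \<noteq> 0 \<longrightarrow> g (R v) v / den v = g (R w) w / den w"
  define Q where "Q k a b = g (R a) b - k * (g y y * g a b - g y a * g y b)" for k a b
  have Q_sym: "Q k a b = Q k b a" for k a b
    by (simp add: Q_def R_sym[of a b] g_sym[of a b] algebra_simps)
  have "\<exists>k. \<forall>v. Q k v v = 0"
  proof (cases "\<exists>u. den u \<noteq> 0")
    case True
    then obtain u where u: "den u \<noteq> 0" by blast
    define k where "k = g (R u) u / den u"
    have Q0: "Q k w w * den w = 0" for w
    proof (cases "den w = 0")
      case False
      then have "g (R w) w / den w = k" using indep u unfolding k_def by blast
      then show ?thesis using False by (simp add: Q_def den_def power2_eq_square field_simps)
    qed simp
    have Qu: "Q k u u = 0" using Q0[of u] u by simp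
    have "Q k v v = 0" for v
    proof -
      define d1 where "d1 = g y y * g v u - g y v * g y u"
      have "den (v + t *\<^sub>R u) = den v + 2 * t * d1 + t * t * den u" for t
        by (simp add: den_def d1_def lin g_sym[of u v] power2_eq_square algebra_simps)
      moreover have "Q k (v + t *\<^sub>R u) (v + t *\<^sub>R u) = Q k v v + 2 * t * Q k v u + t * t * Q k u u" for t
        using R_sym[of u v]
        by (simp add: Q_def lin linear_add[OF R] linear_scale[OF R] g_sym[of u v] algebra_simps)
      ultimately have cubic: "(Q k v v + 2 * t * Q k v u) * (den v + 2 * t * d1 + t * t * den u) = 0" for t
        using Q0[of "v + t *\<^sub>R u"] by (simp add: Qu)
      have "Q k v v * den v + (2 * Q k v v * d1 + 2 * Q k v u * den v) * t
          + (Q k v v * den u + 4 * Q k v u * d1) * t\<^sup>2 + 2 * Q k v u * den u * t ^ 3 = 0" for t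
        using cubic[of t] by (simp add: algebra_simps power2_eq_square power3_eq_cube)
      from cubic_coefficients_zero[OF this]
      have "2 * Q k v u * den u = 0 \<and> Q k v v * den u + 4 * Q k v u * d1 = 0" by blast
      then show ?thesis using u by auto
    qed
    then show ?thesis by blast
  next
    case False
    then have d: "den v = 0" for v by blast
    have polar: "g y y * g a b = g y a * g y b" for a b
      using d[of "a + b"] d[of a] d[of b]
      by (simp add: den_def lin g_sym[of b a] power2_eq_square algebra_simps)
    have "g y y * g (R v) v = 0" for v
      unfolding polar[of "R v" v] R_y by simp
    then show ?thesis using y by (intro exI[of _ 0]) (simp add: Q_def)
  qed
  then obtain k where Qk: "Q k v v = 0" for v by blast
  have Q0: "Q k a b = 0" for a b
    using Qk[of "a + b"] Qk[of a] Qk[of b] Q_sym[of k a b]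
    by (simp add: Q_def lin linear_add[OF R] algebra_simps)
  have "R v = (k * g y y) *\<^sub>R v + (- k * g y v) *\<^sub>R y" for v
  proof -
    have "g a (R v - ((k * g y y) *\<^sub>R v + (- k * g y v) *\<^sub>R y)) = 0" for a
      using Q0[of v a] by (simp add: Q_def lin g_sym[of a] algebra_simps)
    from nondeg[OF this] show ?thesis by simp
  qed
  then show "\<exists>c \<omega>. \<forall>v. R v = c *\<^sub>R v + \<omega> v *\<^sub>R y"
    by (intro exI[of _ "k * g y y"] exI[of _ "\<lambda>v. - k * g y v"]) blast
qed

section \<open>The canonical spray of a Finsler function in a chart\<close>

lemma px_eq: "px i F = \<partial> (axis i 1, 0) F" and py_eq: "py i F = \<partial> (0, axis i 1) F"
  by (simp_all add: px_def py_def dir_deriv_def)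

text \<open>Turns contractions with coordinate indices into directional derivatives.\<close>

lemma linear_axis_sum:
  fixes h :: "real ^ 'n::finite \<Rightarrow> 'b::real_vector"
  assumes "linear h"
  shows "(\<Sum>i\<in>UNIV. v $ i *\<^sub>R h (axis i 1)) = h v"
proof -
  have "h v = h (\<Sum>i\<in>UNIV. v $ i *\<^sub>R axis i 1)"
    using basis_expansion[of v] by (simp add: scalar_mult_eq_scaleR)
  then show ?thesis by (simp add: linear_sum[OF assms] linear_scale[OF assms])
qed

lemma linear_axis_sum_real:
  fixes h :: "real ^ 'n::finite \<Rightarrow> real"
  assumes "linear h"
  shows "(\<Sum>i\<in>UNIV. v $ i * h (axis i 1)) = h v" "(\<Sum>i\<in>UNIV. h (axis i 1) * v $ i) = h v"
  using linear_axis_sum[OF assms, of v] by (simp_all add: mult.commute)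

lemma smooth_linear_slots:
  fixes F :: "'v::euclidean_space \<times> 'v \<Rightarrow> 'b::euclidean_space"
  assumes "open U" "smooth_on U F" "z \<in> U"
  shows "linear (\<lambda>v. \<partial> (v, 0) F z)" "linear (\<lambda>v. \<partial> (0, v) F z)"
    "linear (\<lambda>v. \<partial> u (\<partial> (v, 0) F) z)" "linear (\<lambda>v. \<partial> u (\<partial> (0, v) F) z)"
proof -
  have *: "linear (\<lambda>v::'v. (v, 0::'v))" "linear (\<lambda>v::'v. (0::'v, v))" by (auto intro!: linearI)
  note l1 = smooth_on_linear_dir_deriv[OF assms(2,3)]
  note l2 = dir_deriv2_linear_direction[OF assms]
  show "linear (\<lambda>v. \<partial> (v, 0) F z)" "linear (\<lambda>v. \<partial> (0, v) F z)"
    "linear (\<lambda>v. \<partial> u (\<partial> (v, 0) F) z)" "linear (\<lambda>v. \<partial> u (\<partial> (0, v) F) z)"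
    using linear_compose[OF *(1) l1] linear_compose[OF *(2) l1] linear_compose[OF *(1) l2] linear_compose[OF *(2) l2]
    by (simp_all add: o_def)
qed

definition spray_vec :: "'n::finite lfun \<Rightarrow> (real ^ 'n) \<times> (real ^ 'n) \<Rightarrow> real ^ 'n" where
  "spray_vec L z = (\<chi> i. spray L i z)"

lemma spray_eq: "spray L i = (\<lambda>z. spray_vec L z $ i)"
  by (simp add: spray_vec_def)

definition fund_form :: "'n::finite lfun \<Rightarrow> (real ^ 'n) \<times> (real ^ 'n) \<Rightarrow> real ^ 'n \<Rightarrow> real ^ 'n \<Rightarrow> real" where
  "fund_form L z a b = 1/2 * \<partial> (0, a) (\<partial> (0, b) (\<lambda>w. (L w)\<^sup>2)) z"

text \<open>Homogeneity enters only through Euler's relation at the points of \<open>U\<close>, because the set on which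
  \<open>\<phi>\<close> is assumed to vanish is open but not necessarily a cone.\<close>

locale finsler_chart =
  fixes U :: "((real ^ 'n::finite) \<times> (real ^ 'n)) set" and L :: "'n lfun"
  assumes open_U: "open U"
    and smooth_L: "smooth_on U L"
    and pos_L: "\<And>z. z \<in> U \<Longrightarrow> L z > 0"
    and euler_L: "\<And>z. z \<in> U \<Longrightarrow> \<partial> (0, snd z) L z = L z"
    and regular: "\<And>z. z \<in> U \<Longrightarrow> invertible (metric L z)"
begin

abbreviation E :: "'n lfun" where "E \<equiv> \<lambda>w. (L w)\<^sup>2"
abbreviation G where "G \<equiv> spray_vec L"

lemma smooth_E: "smooth_on U E"
  using smooth_on_mult[OF open_U smooth_L smooth_L] by (simp add: power2_eq_square)

lemmas smooth_dE = smooth_on_dir_deriv[OF smooth_E]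

lemma dir_deriv_E: "z \<in> U \<Longrightarrow> \<partial> u E z = 2 * L z * \<partial> u L z"
  by (rule dir_deriv_eqI) (auto intro!: derivative_eq_intros smooth_on_has_derivative[OF smooth_L])

lemma euler_E: "z \<in> U \<Longrightarrow> \<partial> (0, snd z) E z = 2 *\<^sub>R E z"
  by (simp only: dir_deriv_E euler_L) (simp add: power2_eq_square)

lemma euler_dE: "z \<in> U \<Longrightarrow> \<partial> u (\<partial> (0, snd z) E) z = 2 * \<partial> u E z - \<partial> (0, snd u) E z"
  using euler_dir_deriv[OF open_U smooth_E euler_E] by simp

lemma euler_vert_E: "z \<in> U \<Longrightarrow> \<partial> (0, snd z) (\<partial> (0, v) E) z = 1 *\<^sub>R \<partial> (0, v) E z"
  unfolding dir_deriv_commute[OF open_U smooth_E, of z "(0, snd z)"] euler_dE by simp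

lemma euler_dvert_E: "z \<in> U \<Longrightarrow> \<partial> u (\<partial> (0, snd z) (\<partial> (0, v) E)) z = \<partial> u (\<partial> (0, v) E) z - \<partial> (0, snd u) (\<partial> (0, v) E) z"
  using euler_dir_deriv[OF open_U smooth_dE euler_vert_E] by simp

lemma metric_eq: "metric L z $ i $ j = fund_form L z (axis i 1) (axis j 1)"
  by (simp add: metric_def fund_form_def py_eq)

lemma fund_form_sym: "z \<in> U \<Longrightarrow> fund_form L z a b = fund_form L z b a"
  by (simp add: fund_form_def dir_deriv_commute[OF open_U smooth_E, of z "(0, a)"])

lemma linear_fund_form:
  assumes z: "z \<in> U" shows "linear (fund_form L z a)" "linear (\<lambda>a. fund_form L z a b)"
  using linear_compose_scale_right[OF smooth_linear_slots(4)[OF open_U smooth_E z], of "1/2" "(0, a)"]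
    linear_compose_scale_right[OF smooth_linear_slots(2)[OF open_U smooth_dE z], of "1/2" "(0, b)"]
  by (simp_all add: fund_form_def[abs_def])

lemma bilinear_fund_form: "z \<in> U \<Longrightarrow> bilinear (fund_form L z)"
  by (simp add: bilinear_def linear_fund_form)

lemma metric_sum:
  assumes z: "z \<in> U"
  shows "(\<Sum>j\<in>UNIV. metric L z $ i $ j * v $ j) = fund_form L z (axis i 1) v"
    and "(\<Sum>i\<in>UNIV. \<Sum>j\<in>UNIV. metric L z $ i $ j * u $ i * v $ j) = fund_form L z u v"
proof -
  show 1: "(\<Sum>j\<in>UNIV. metric L z $ i $ j * v $ j) = fund_form L z (axis i 1) v" for i
    unfolding metric_eq by (rule linear_axis_sum_real(2)[OF linear_fund_form(1)[OF z]])
  have "(\<Sum>i\<in>UNIV. \<Sum>j\<in>UNIV. metric L z $ i $ j * u $ i * v $ j) =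
      (\<Sum>i\<in>UNIV. u $ i * (\<Sum>j\<in>UNIV. metric L z $ i $ j * v $ j))"
    by (simp add: sum_distrib_left mult_ac)
  also have "\<dots> = fund_form L z u v"
    unfolding 1 by (rule linear_axis_sum_real(1)[OF linear_fund_form(2)[OF z]])
  finally show "(\<Sum>i\<in>UNIV. \<Sum>j\<in>UNIV. metric L z $ i $ j * u $ i * v $ j) = fund_form L z u v" .
qed

lemma fund_form_nondegenerate:
  assumes z: "z \<in> U" and "\<And>a. fund_form L z a b = 0"
  shows "b = 0"
proof -
  have "metric L z *v b = 0"
    by (simp add: vec_eq_iff matrix_vector_mult_def metric_sum[OF z] assms(2))
  moreover obtain A where "A ** metric L z = mat 1"
    using regular[OF z] by (auto simp: invertible_def)
  ultimately show ?thesis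
    by (metis matrix_vector_mul_assoc matrix_vector_mul_lid matrix_vector_mult_0_right)
qed

text \<open>Contraction of the metric with \<open>y\<close>: \<open>y\<^sub>i\<close> is half the vertical derivative of \<open>L\<^sup>2\<close>.\<close>

lemma fund_form_y: "z \<in> U \<Longrightarrow> fund_form L z a (snd z) = 1/2 * \<partial> (0, a) E z"
  unfolding fund_form_def euler_dE by simp

lemma fund_form_y_y: "z \<in> U \<Longrightarrow> fund_form L z (snd z) (snd z) = (L z)\<^sup>2"
  by (simp add: fund_form_y euler_E)

lemma y_low_eq: "z \<in> U \<Longrightarrow> y_low L i z = fund_form L z (axis i 1) (snd z)"
  by (simp add: y_low_def metric_sum)

text \<open>The components \<open>g\<^sub>l\<^sub>i G\<^sup>i\<close>, as read off from the Euler-Lagrange equations.\<close>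

definition spray_covector :: "'n \<Rightarrow> 'n lfun" where
  "spray_covector l z = 1/4 * (\<partial> (snd z, 0) (\<partial> (0, axis l 1) E) z - \<partial> (axis l 1, 0) E z)"

text \<open>The first two terms coincide after contraction with \<open>y\<close>.  In each term, one contraction with \<open>y\<close>
  meets a second vertical derivative of \<open>L\<^sup>2\<close> and, as first vertical derivatives have degree one in \<open>y\<close>,
  lowers its order by one.\<close>

lemma christoffel_contract:
  assumes z: "z \<in> U"
  shows "(\<Sum>j\<in>UNIV. \<Sum>k\<in>UNIV. (px j (\<lambda>w. metric L w $ k $ r) z + px k (\<lambda>w. metric L w $ j $ r) z
           - px r (\<lambda>w. metric L w $ j $ k) z) * snd z $ j * snd z $ k) = 4 * spray_covector r z"
proof -
  let ?y = "snd z" and ?e = "\<lambda>i. axis i 1 :: real ^ 'n"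
  note comm = dir_deriv_commute[OF open_U smooth_E]
  have pxm: "px i (\<lambda>w. metric L w $ j $ k) z = 1/2 * \<partial> (?e i, 0) (\<partial> (0, ?e j) (\<partial> (0, ?e k) E)) z" for i j k
    unfolding px_eq metric_eq fund_form_def
    by (intro dir_deriv_linear bounded_linear_mult_right)
      (rule smooth_on_differentiable[OF smooth_on_dir_deriv[OF smooth_dE] z])
  have d3: "\<partial> u (\<partial> v (\<partial> w E)) z = \<partial> u (\<partial> w (\<partial> v E)) z" for u v w
    by (rule dir_deriv_cong[OF open_U z]) (rule comm)
  have pxm': "px i (\<lambda>w. metric L w $ j $ k) z = 1/2 * \<partial> (?e i, 0) (\<partial> (0, ?e k) (\<partial> (0, ?e j) E)) z" for i j k
    unfolding pxm by (subst d3) (rule refl)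
  have swap: "\<partial> (?y, 0) (\<partial> (0, ?y) (\<partial> (0, a) E)) z = \<partial> (?y, 0) (\<partial> (0, a) E) z" for a
    unfolding euler_dvert_E[OF z] by (simp add: linear_0[OF smooth_linear_slots(2)[OF open_U smooth_dE z]])
  have A: "(\<Sum>j\<in>UNIV. \<Sum>k\<in>UNIV. px j (\<lambda>w. metric L w $ k $ r) z * ?y $ j * ?y $ k) =
      1/2 * \<partial> (?y, 0) (\<partial> (0, ?e r) E) z"
  proof -
    have "(\<Sum>j\<in>UNIV. \<Sum>k\<in>UNIV. px j (\<lambda>w. metric L w $ k $ r) z * ?y $ j * ?y $ k) =
      1/2 * (\<Sum>j\<in>UNIV. ?y $ j * (\<Sum>k\<in>UNIV. ?y $ k * \<partial> (?e j, 0) (\<partial> (0, ?e k) (\<partial> (0, ?e r) E)) z))"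
      unfolding pxm by (simp add: sum_distrib_left mult_ac)
    also have "\<dots> = 1/2 * \<partial> (?y, 0) (\<partial> (0, ?y) (\<partial> (0, ?e r) E)) z"
      unfolding linear_axis_sum_real(1)[OF smooth_linear_slots(4)[OF open_U smooth_dE z]]
        linear_axis_sum_real(1)[OF smooth_linear_slots(1)[OF open_U smooth_on_dir_deriv[OF smooth_dE] z]] ..
    finally show ?thesis unfolding swap .
  qed
  have B: "(\<Sum>j\<in>UNIV. \<Sum>k\<in>UNIV. px k (\<lambda>w. metric L w $ j $ r) z * ?y $ j * ?y $ k) =
      1/2 * \<partial> (?y, 0) (\<partial> (0, ?e r) E) z"
    unfolding A[symmetric] by (subst sum.swap) (simp add: mult_ac)
  have C: "(\<Sum>j\<in>UNIV. \<Sum>k\<in>UNIV. px r (\<lambda>w. metric L w $ j $ k) z * ?y $ j * ?y $ k) =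
      \<partial> (?e r, 0) E z"
  proof -
    have "(\<Sum>j\<in>UNIV. \<Sum>k\<in>UNIV. px r (\<lambda>w. metric L w $ j $ k) z * ?y $ j * ?y $ k) =
      1/2 * (\<Sum>j\<in>UNIV. ?y $ j * (\<Sum>k\<in>UNIV. ?y $ k * \<partial> (?e r, 0) (\<partial> (0, ?e k) (\<partial> (0, ?e j) E)) z))"
      unfolding pxm' by (simp add: sum_distrib_left mult_ac)
    also have "\<dots> = 1/2 * (\<Sum>j\<in>UNIV. ?y $ j * \<partial> (?e r, 0) (\<partial> (0, ?e j) E) z)"
      unfolding linear_axis_sum_real(1)[OF smooth_linear_slots(4)[OF open_U smooth_dE z]] euler_dvert_E[OF z]
      by (simp add: linear_0[OF smooth_linear_slots(2)[OF open_U smooth_dE z]])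
    also have "\<dots> = \<partial> (?e r, 0) E z"
      unfolding linear_axis_sum_real(1)[OF smooth_linear_slots(4)[OF open_U smooth_E z]] euler_dE[OF z]
      by (simp add: linear_0[OF smooth_linear_slots(2)[OF open_U smooth_E z]])
    finally show ?thesis .
  qed
  show ?thesis
    by (simp add: algebra_simps sum.distrib sum_subtractf A[simplified mult_ac] B[simplified mult_ac] C[simplified mult_ac] spray_covector_def)
qed

lemma metric_inv_metric: "z \<in> U \<Longrightarrow> metric L z ** inv_metric L z = mat 1"
  unfolding inv_metric_def matrix_inv_def
  using someI_ex[OF regular[unfolded invertible_def]] by blast

lemma fund_form_spray:
  assumes z: "z \<in> U"
  shows "fund_form L z (axis l 1) (G z) = spray_covector l z"
proof -
  have G: "G z = inv_metric L z *v (\<chi> r. spray_covector r z)"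
  proof (subst vec_eq_iff, rule allI)
    fix i
    have "spray L i z = 1/4 * (\<Sum>j\<in>UNIV. \<Sum>k\<in>UNIV. \<Sum>r\<in>UNIV. inv_metric L z $ i $ r * ((px j (\<lambda>w. metric L w $ k $ r) z + px k (\<lambda>w. metric L w $ j $ r) z
           - px r (\<lambda>w. metric L w $ j $ k) z) * snd z $ j * snd z $ k))"
      unfolding spray_def formal_christoffel_def
      by (simp add: sum_distrib_left sum_distrib_right mult_ac)
    also have "\<dots> = 1/4 * (\<Sum>r\<in>UNIV. \<Sum>j\<in>UNIV. \<Sum>k\<in>UNIV. inv_metric L z $ i $ r * ((px j (\<lambda>w. metric L w $ k $ r) z + px k (\<lambda>w. metric L w $ j $ r) z
           - px r (\<lambda>w. metric L w $ j $ k) z) * snd z $ j * snd z $ k))"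
      by (subst sum.swap[of _ _ "UNIV :: 'n set", symmetric]) (subst (2) sum.swap, simp)
    also have "\<dots> = (\<Sum>r\<in>UNIV. inv_metric L z $ i $ r * spray_covector r z)"
      unfolding sum_distrib_left[symmetric] christoffel_contract[OF z] by (simp add: sum_distrib_left)
    finally show "G z $ i = (inv_metric L z *v (\<chi> r. spray_covector r z)) $ i"
      by (simp add: spray_vec_def matrix_vector_mult_def)
  qed
  have "metric L z *v G z = (\<chi> r. spray_covector r z)"
    unfolding G by (simp add: matrix_vector_mul_assoc metric_inv_metric[OF z])
  then have "(metric L z *v G z) $ l = spray_covector l z" by simp
  then show ?thesis by (simp add: matrix_vector_mult_def metric_sum[OF z])
qed

lemma spray_euler_lagrange:
  assumes z: "z \<in> U"
  shows "\<partial> (spray_field G z) (\<partial> (0, v) E) z = \<partial> (v, 0) E z"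
proof -
  have axis: "\<partial> (spray_field G z) (\<partial> (0, axis l 1) E) z = \<partial> (axis l 1, 0) E z" for l
  proof -
    have "\<partial> (spray_field G z) (\<partial> (0, axis l 1) E) z = \<partial> (snd z, 0) (\<partial> (0, axis l 1) E) z - 2 * \<partial> (0, G z) (\<partial> (0, axis l 1) E) z"
      unfolding spray_field_def
      by (subst dir_deriv_Pair_simps(1)[OF smooth_dE z]) (simp add: dir_deriv_Pair_simps(3-)[OF smooth_dE z])
    then show ?thesis
      using fund_form_spray[OF z, of l] fund_form_sym[OF z, of "G z"]
      by (simp add: fund_form_def spray_covector_def)
  qed
  show ?thesis
    using linear_axis_sum_real(1)[OF smooth_linear_slots(4)[OF open_U smooth_E z], of v "spray_field G z"]
      linear_axis_sum_real(1)[OF smooth_linear_slots(1)[OF open_U smooth_E z], of v]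
    by (simp add: axis)
qed

lemma smooth_metric: "smooth_on U (\<lambda>z. metric L z $ i $ j)"
  unfolding metric_eq fund_form_def
  by (intro smooth_on_linear[OF open_U bounded_linear_mult_right] smooth_on_dir_deriv smooth_E)

lemma smooth_y: "smooth_on U (\<lambda>z. (snd z, 0 :: real ^ 'n))"
  by (intro smooth_on_Pair smooth_on_const smooth_on_bounded_linear bounded_linear_snd open_U)

lemma smooth_det:
  assumes "\<And>i j. smooth_on U (\<lambda>z. A z $ i $ j)"
  shows "smooth_on U (\<lambda>z. det (A z :: real ^ 'n ^ 'n))"
  unfolding det_def by (intro smooth_on_sum smooth_on_mult smooth_on_prod smooth_on_const open_U assms)

text \<open>Cramer's rule for the linear system \<open>g\<^sub>l\<^sub>i G\<^sup>i = spray_covector l\<close> shows smoothness of \<open>G\<close> from that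
  of the metric and of the determinant.\<close>

lemma smooth_spray: "smooth_on U G"
proof -
  let ?C = "\<lambda>z k. (\<chi> i j. if j = k then spray_covector i z else metric L z $ i $ j) :: real ^ 'n ^ 'n"
  have det: "det (metric L z) \<noteq> 0" if "z \<in> U" for z
    using regular[OF that] by (simp add: invertible_det_nz)
  have cov: "smooth_on U (spray_covector i)" for i
    unfolding spray_covector_def[abs_def]
    by (intro smooth_on_linear[OF open_U bounded_linear_mult_right] smooth_on_diff[OF open_U] smooth_on_along_field[OF open_U _ smooth_y] smooth_dE)
  have smooth_entry: "smooth_on U (\<lambda>z. if j = k then spray_covector i z else metric L z $ i $ j)" for i j k
    by (cases "j = k") (simp_all add: cov smooth_metric)
  have "smooth_on U (\<lambda>z. \<chi> k. det (?C z k) / det (metric L z))"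
    by (intro smooth_on_vec smooth_on_divide open_U smooth_det smooth_metric det)
      (simp add: smooth_entry)
  moreover have "(\<chi> k. det (?C z k) / det (metric L z)) = G z" if z: "z \<in> U" for z
  proof -
    have "metric L z *v G z = (\<chi> i. spray_covector i z)"
      by (simp add: vec_eq_iff matrix_vector_mult_def metric_sum[OF z] fund_form_spray[OF z])
    then show ?thesis using cramer[OF det[OF z], of "G z" "\<chi> i. spray_covector i z"] by (simp cong: if_cong)
  qed
  ultimately show ?thesis by (rule smooth_on_cong[OF open_U, rotated])
qed

text \<open>Apply \<open>y\<^sup>i \<partial>/\<partial>y\<^sup>i\<close> to the Euler-Lagrange equations, in which every other ingredient has a known
  degree, and cancel the metric.\<close>

lemma euler_spray:
  assumes z: "z \<in> U"
  shows "\<partial> (0, snd z) G z = 2 *\<^sub>R G z"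
proof -
  let ?y = "snd z"
  have "fund_form L z (2 *\<^sub>R G z - \<partial> (0, ?y) G z) v = 0" for v
  proof -
    let ?F = "\<partial> (0, v) E"
    have split: "\<partial> (a, - 2 *\<^sub>R b) ?F z = \<partial> (a, 0) ?F z - 2 * \<partial> (0, b) ?F z" for a b
      by (subst dir_deriv_Pair_simps(1)[OF smooth_dE z]) (simp add: dir_deriv_Pair_simps(3-)[OF smooth_dE z])
    have "\<partial> (0, ?y) (\<lambda>w. \<partial> (spray_field G w) ?F w) z = \<partial> (0, ?y) (\<partial> (v, 0) E) z"
      by (rule dir_deriv_cong[OF open_U z]) (rule spray_euler_lagrange)
    then have "\<partial> (0, ?y) (\<partial> (spray_field G z) ?F) z + \<partial> (?y, - 2 *\<^sub>R \<partial> (0, ?y) G z) ?F z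
        = \<partial> (0, ?y) (\<partial> (v, 0) E) z"
      by (subst (asm) dir_deriv_eqI[OF has_derivative_along_field[OF open_U smooth_dE z has_derivative_spray_field[OF smooth_spray z]]]) simp
    moreover have "\<partial> (0, ?y) (\<partial> (spray_field G z) ?F) z = \<partial> (v, 0) E z + 2 * \<partial> (0, G z) ?F z"
      unfolding dir_deriv_commute[OF open_U smooth_dE z, of "(0, ?y)"] euler_dvert_E[OF z] spray_euler_lagrange[OF z]
      using dir_deriv_Pair_simps(5)[OF smooth_dE z, of "-2" "G z"] by (simp add: spray_field_def)
    moreover have "\<partial> (0, ?y) (\<partial> (v, 0) E) z = 2 * \<partial> (v, 0) E z"
      unfolding dir_deriv_commute[OF open_U smooth_E z, of "(0, ?y)"] euler_dE[OF z]
      by (simp add: linear_0[OF smooth_linear_slots(2)[OF open_U smooth_E z]])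
    moreover have "\<partial> (?y, 0) ?F z - 2 * \<partial> (0, G z) ?F z = \<partial> (v, 0) E z"
      using spray_euler_lagrange[OF z, of v] by (simp only: spray_field_def split)
    ultimately have "2 * \<partial> (0, G z) ?F z = \<partial> (0, \<partial> (0, ?y) G z) ?F z"
      unfolding split by linarith
    then show ?thesis
      by (simp add: fund_form_def dir_deriv_Pair_simps(3,5)[OF smooth_dE z])
  qed
  then show ?thesis
    using fund_form_nondegenerate[OF z, of "2 *\<^sub>R G z - \<partial> (0, ?y) G z"] fund_form_sym[OF z] by simp
qed

sublocale metric_spray U G E
  by unfold_locales (use open_U smooth_spray euler_spray smooth_E euler_E spray_euler_lagrange in auto)

lemma py_spray: "z \<in> U \<Longrightarrow> py k (spray L i) z = \<partial> (0, axis k 1) G z $ i"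
  unfolding py_eq spray_eq
  by (intro dir_deriv_linear bounded_linear_vec_nth) (rule smooth_on_differentiable[OF smooth_spray])

lemma px_spray: "z \<in> U \<Longrightarrow> px k (spray L i) z = \<partial> (axis k 1, 0) G z $ i"
  unfolding px_eq spray_eq
  by (intro dir_deriv_linear bounded_linear_vec_nth) (rule smooth_on_differentiable[OF smooth_spray])

lemma dir_deriv_py_spray:
  assumes z: "z \<in> U" shows "\<partial> u (py k (spray L i)) z = \<partial> u (\<partial> (0, axis k 1) G) z $ i"
proof -
  have "\<partial> u (py k (spray L i)) z = \<partial> u (\<lambda>z. \<partial> (0, axis k 1) G z $ i) z"
    by (rule dir_deriv_cong[OF open_U z]) (rule py_spray)
  also have "\<dots> = \<partial> u (\<partial> (0, axis k 1) G) z $ i"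
    by (intro dir_deriv_linear bounded_linear_vec_nth) (rule smooth_on_differentiable[OF smooth_on_dir_deriv[OF smooth_spray] z])
  finally show ?thesis .
qed

lemma riemann_eq:
  assumes z: "z \<in> U" shows "riemann L i k z = jacobi_endo G (axis k 1) z $ i"
proof -
  let ?F = "\<partial> (0, axis k 1) G"
  have F: "smooth_on U ?F" by (rule smooth_on_dir_deriv[OF smooth_spray])
  have 1: "(\<Sum>j\<in>UNIV. v $ j * px j (py k (spray L i)) z) = \<partial> (v, 0) ?F z $ i" for v
    unfolding px_eq dir_deriv_py_spray[OF z]
    by (subst linear_axis_sum[OF smooth_linear_slots(1)[OF open_U F z], symmetric]) simp
  have 2: "(\<Sum>j\<in>UNIV. v $ j * py j (py k (spray L i)) z) = \<partial> (0, v) ?F z $ i" for v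
    unfolding py_eq[of _ "py _ _"] dir_deriv_py_spray[OF z]
    by (subst linear_axis_sum[OF smooth_linear_slots(2)[OF open_U F z], symmetric]) simp
  have 3: "(\<Sum>j\<in>UNIV. py j (spray L i) z * v $ j) = \<partial> (0, v) G z $ i" for v
    unfolding py_spray[OF z]
    by (subst linear_axis_sum[OF smooth_linear_slots(2)[OF open_U smooth_spray z], symmetric]) (simp add: mult.commute)
  have 4: "\<partial> (spray_field G z) ?F z = \<partial> (snd z, 0) ?F z - 2 *\<^sub>R \<partial> (0, G z) ?F z"
    unfolding spray_field_def
    by (subst dir_deriv_Pair_simps(1)[OF F z]) (simp add: dir_deriv_Pair_simps(3-)[OF F z])
  show ?thesis
    unfolding riemann_def 1 px_spray[OF z] py_spray[OF z, of k] 3 jacobi_endo_def 4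
      fun_cong[OF spray_eq] 2
    by simp
qed

text \<open>The flag curvature in the direction \<open>V\<close> is the quotient \<open>g(R V, V) / (g(y, y) g(V, V) - g(y, V)\<^sup>2)\<close>.\<close>

lemma flag_curvature_independent_iff:
  assumes z: "z \<in> U"
  shows "(\<forall>V W. flag_denom L z V \<noteq> 0 \<longrightarrow> flag_denom L z W \<noteq> 0 \<longrightarrow>
        flag_curvature L z V = flag_curvature L z W) \<longleftrightarrow>
     (\<exists>c \<omega>. \<forall>v. jacobi_endo G v z = c *\<^sub>R v + \<omega> v *\<^sub>R snd z)"
proof -
  let ?g = "fund_form L z" and ?y = "snd z" and ?R = "\<lambda>v. jacobi_endo G v z"
  have den: "flag_denom L z V = ?g ?y ?y * ?g V V - (?g ?y V)\<^sup>2" for V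
    unfolding flag_denom_def metric_sum[OF z] y_low_eq[OF z] fund_form_y_y[OF z]
      linear_axis_sum_real(2)[OF linear_fund_form(2)[OF z]]
    using fund_form_sym[OF z, of V ?y] by simp
  have num: "(\<Sum>i\<in>UNIV. \<Sum>j\<in>UNIV. \<Sum>k\<in>UNIV. metric L z $ i $ j * riemann L i k z * V $ k * V $ j) = ?g (?R V) V" for V
  proof -
    have R: "(\<Sum>k\<in>UNIV. riemann L i k z * V $ k) = ?R V $ i" for i
      unfolding riemann_eq[OF z]
      by (subst linear_axis_sum[OF linear_jacobi_endo[OF z], symmetric]) (simp add: mult.commute)
    have "(\<Sum>i\<in>UNIV. \<Sum>j\<in>UNIV. \<Sum>k\<in>UNIV. metric L z $ i $ j * riemann L i k z * V $ k * V $ j) =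
      (\<Sum>i\<in>UNIV. \<Sum>j\<in>UNIV. metric L z $ i $ j * (\<Sum>k\<in>UNIV. riemann L i k z * V $ k) * V $ j)"
      by (simp add: sum_distrib_left sum_distrib_right mult_ac)
    then show ?thesis unfolding R metric_sum[OF z] .
  qed
  show ?thesis
    unfolding flag_curvature_def num den
  proof (rule sectional_quotient_constant_iff)
    show "bilinear ?g" by (rule bilinear_fund_form[OF z])
    show "?g a b = ?g b a" for a b by (rule fund_form_sym[OF z])
    show "b = 0" if "\<And>a. ?g a b = 0" for b using fund_form_nondegenerate[OF z that] .
    show "linear ?R" by (rule linear_jacobi_endo[OF z])
    show "?g (?R a) b = ?g (?R b) a" for a b
      using jacobi_endo_symmetric[OF z, of b a] fund_form_sym[OF z, of "?R a" b] fund_form_sym[OF z, of "?R b" a]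
      by (simp add: fund_form_def)
    show "?g ?y (?R a) = 0" for a
      unfolding fund_form_sym[OF z, of ?y "?R a"] fund_form_y[OF z] energy_jacobi_endo[OF z] by simp
    show "?g ?y ?y \<noteq> 0" using pos_L[OF z] by (simp add: fund_form_y_y[OF z])
  qed
qed

end

section \<open>Cartan connection coefficients and the supporting direction\<close>

context finsler_chart
begin

lemma nonlin_conn_eq: "z \<in> U \<Longrightarrow> nonlin_conn L r i z = \<partial> (0, axis i 1) G z $ r"
  unfolding nonlin_conn_def by (rule py_spray)

lemma hor_deriv_eq:
  assumes z: "z \<in> U" and F: "smooth_on U F"
  shows "hor_deriv L i F z = px i F z - \<partial> (0, \<partial> (0, axis i 1) G z) F z"
  unfolding hor_deriv_def nonlin_conn_eq[OF z] py_eq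
  using linear_axis_sum_real(1)[OF smooth_linear_slots(2)[OF open_U F z]] by simp

lemma hor_deriv_metric_sym:
  assumes z: "z \<in> U"
  shows "hor_deriv L i (\<lambda>w. metric L w $ j $ k) z = hor_deriv L i (\<lambda>w. metric L w $ k $ j) z"
proof -
  have "\<partial> v (\<lambda>w. metric L w $ j $ k) z = \<partial> v (\<lambda>w. metric L w $ k $ j) z" for v
    by (rule dir_deriv_cong[OF open_U z]) (simp add: metric_eq fund_form_sym)
  then show ?thesis by (simp add: hor_deriv_def px_eq py_eq)
qed

lemma cartan_christoffel_sym: "z \<in> U \<Longrightarrow> cartan_christoffel L i j k z = cartan_christoffel L i k j z"
  unfolding cartan_christoffel_def by (simp add: hor_deriv_metric_sym[of z _ j k] add.commute)

lemma vertical_metric_y: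
  assumes z: "z \<in> U"
  shows "(\<Sum>k\<in>UNIV. snd z $ k * \<partial> (0, a) (\<lambda>w. metric L w $ k $ r) z) = 0"
proof -
  have eq: "\<partial> (0, a) (\<lambda>w. metric L w $ k $ r) z = 1/2 * \<partial> (0, a) (\<partial> (0, axis k 1) (\<partial> (0, axis r 1) E)) z" for k
    unfolding metric_eq fund_form_def
    by (intro dir_deriv_linear bounded_linear_mult_right)
      (rule smooth_on_differentiable[OF smooth_on_dir_deriv[OF smooth_dE] z])
  have "(\<Sum>k\<in>UNIV. snd z $ k * \<partial> (0, a) (\<lambda>w. metric L w $ k $ r) z) =
      1/2 * (\<Sum>k\<in>UNIV. snd z $ k * \<partial> (0, a) (\<partial> (0, axis k 1) (\<partial> (0, axis r 1) E)) z)"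
    by (simp only: eq sum_distrib_left) (simp add: mult_ac)
  then show ?thesis
    unfolding linear_axis_sum_real(1)[OF smooth_linear_slots(4)[OF open_U smooth_dE z]] euler_dvert_E[OF z] by simp
qed

text \<open>Horizontal and partial derivatives of the metric differ by vertical derivatives, which vanish
  after contraction with \<open>y\<close>.\<close>

lemma hor_deriv_metric_y:
  assumes z: "z \<in> U"
  shows "(\<Sum>k\<in>UNIV. snd z $ k * hor_deriv L j (\<lambda>w. metric L w $ k $ r) z) =
    (\<Sum>k\<in>UNIV. snd z $ k * px j (\<lambda>w. metric L w $ k $ r) z)"
  unfolding hor_deriv_eq[OF z smooth_metric]
  by (simp add: right_diff_distrib sum_subtractf vertical_metric_y[OF z])

text \<open>The symbols \<open>\<Gamma>\<close> and \<open>\<gamma>\<close> have the same contraction with \<open>y\<^sup>j y\<^sup>k\<close>.\<close>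

lemma cartan_christoffel_y_y:
  assumes z: "z \<in> U"
  shows "(\<Sum>j\<in>UNIV. \<Sum>k\<in>UNIV. cartan_christoffel L i j k z * snd z $ j * snd z $ k) = 2 * G z $ i"
proof -
  let ?y = "snd z"
  have regroup: "(\<Sum>j\<in>UNIV. \<Sum>k\<in>UNIV. 1/2 * (\<Sum>r\<in>UNIV. inv_metric L z $ i $ r * (X j k r + X k j r - X r j k)) * ?y $ j * ?y $ k)
    = 1/2 * (\<Sum>r\<in>UNIV. inv_metric L z $ i $ r * (
        (\<Sum>j\<in>UNIV. ?y $ j * (\<Sum>k\<in>UNIV. ?y $ k * X j k r)) + (\<Sum>k\<in>UNIV. ?y $ k * (\<Sum>j\<in>UNIV. ?y $ j * X k j r))
        - (\<Sum>k\<in>UNIV. ?y $ k * (\<Sum>j\<in>UNIV. ?y $ j * X r j k))))" for X :: "'n \<Rightarrow> 'n \<Rightarrow> 'n \<Rightarrow> real"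
  proof -
    have inner: "(\<Sum>j\<in>UNIV. \<Sum>k\<in>UNIV. (X j k r + X k j r - X r j k) * ?y $ j * ?y $ k) =
        (\<Sum>j\<in>UNIV. ?y $ j * (\<Sum>k\<in>UNIV. ?y $ k * X j k r)) + (\<Sum>k\<in>UNIV. ?y $ k * (\<Sum>j\<in>UNIV. ?y $ j * X k j r))
        - (\<Sum>k\<in>UNIV. ?y $ k * (\<Sum>j\<in>UNIV. ?y $ j * X r j k))" for r
    proof -
      have "(\<Sum>k\<in>UNIV. ?y $ k * (\<Sum>j\<in>UNIV. ?y $ j * X k j r)) = (\<Sum>j\<in>UNIV. \<Sum>k\<in>UNIV. ?y $ k * (?y $ j * X k j r))"
        "(\<Sum>k\<in>UNIV. ?y $ k * (\<Sum>j\<in>UNIV. ?y $ j * X r j k)) = (\<Sum>j\<in>UNIV. \<Sum>k\<in>UNIV. ?y $ k * (?y $ j * X r j k))"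
        by (simp_all only: sum_distrib_left) (subst sum.swap, rule refl)+
      then show ?thesis
        by (simp add: sum_distrib_left sum.distrib sum_subtractf ring_distribs mult_ac)
    qed
    have "(\<Sum>j\<in>UNIV. \<Sum>k\<in>UNIV. 1/2 * (\<Sum>r\<in>UNIV. inv_metric L z $ i $ r * (X j k r + X k j r - X r j k)) * ?y $ j * ?y $ k)
      = (\<Sum>j\<in>UNIV. \<Sum>k\<in>UNIV. \<Sum>r\<in>UNIV. 1/2 * inv_metric L z $ i $ r * ((X j k r + X k j r - X r j k) * ?y $ j * ?y $ k))"
      by (simp add: sum_distrib_left sum_distrib_right mult_ac)
    also have "\<dots> = (\<Sum>r\<in>UNIV. \<Sum>j\<in>UNIV. \<Sum>k\<in>UNIV. 1/2 * inv_metric L z $ i $ r * ((X j k r + X k j r - X r j k) * ?y $ j * ?y $ k))"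
      by (subst sum.swap[of _ _ "UNIV :: 'n set", symmetric]) (subst (2) sum.swap, simp)
    also have "\<dots> = (\<Sum>r\<in>UNIV. 1/2 * inv_metric L z $ i $ r * (\<Sum>j\<in>UNIV. \<Sum>k\<in>UNIV. (X j k r + X k j r - X r j k) * ?y $ j * ?y $ k))"
      by (simp only: sum_distrib_left)
    finally show ?thesis unfolding inner by (simp add: sum_distrib_left mult_ac)
  qed
  have "(\<Sum>j\<in>UNIV. \<Sum>k\<in>UNIV. cartan_christoffel L i j k z * ?y $ j * ?y $ k) =
      (\<Sum>j\<in>UNIV. \<Sum>k\<in>UNIV. formal_christoffel L i j k z * ?y $ j * ?y $ k)"
    unfolding cartan_christoffel_def formal_christoffel_def
      regroup[of "\<lambda>j k r. hor_deriv L j (\<lambda>w. metric L w $ k $ r) z"]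
      regroup[of "\<lambda>j k r. px j (\<lambda>w. metric L w $ k $ r) z"] hor_deriv_metric_y[OF z] ..
  then show ?thesis by (simp add: spray_vec_def spray_def)
qed

lemma dir_deriv2_energy:
  assumes z: "z \<in> U"
  shows "\<partial> u (\<partial> v E) z = 2 * (\<partial> u L z * \<partial> v L z + L z * \<partial> u (\<partial> v L) z)"
proof -
  have "\<partial> u (\<partial> v E) z = \<partial> u (\<lambda>w. 2 * L w * \<partial> v L w) z"
    by (rule dir_deriv_cong[OF open_U z]) (rule dir_deriv_E)
  also have "\<dots> = 2 * (\<partial> u L z * \<partial> v L z + L z * \<partial> u (\<partial> v L) z)"
    by (rule dir_deriv_eqI)
      (auto intro!: derivative_eq_intros smooth_on_has_derivative[OF smooth_L z]
        smooth_on_has_derivative[OF smooth_on_dir_deriv[OF smooth_L] z] simp: algebra_simps)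
  finally show ?thesis .
qed

end

section \<open>The canonical spray after a \<open>\<beta>\<close>-conformal change\<close>

text \<open>Coordinate expressions of a change in one chart: \<open>Lb\<close> is the new Finsler function, \<open>X\<close> the domain of
  the coordinates \<open>x\<close>, on which \<open>s\<close> and \<open>b\<close> represent \<open>\<sigma>\<close> and \<open>\<beta>\<close>.  The equation for \<open>Lb\<close> is required on
  \<open>U\<close> only, since \<open>\<beta>\<close> is given by its components only over \<open>X\<close>.\<close>

locale beta_change = finsler_chart U L + bar: finsler_chart U Lb
  for U :: "((real ^ 'n::finite) \<times> (real ^ 'n)) set" and L Lb :: "'n lfun" +
  fixes X :: "(real ^ 'n) set" and s :: "real ^ 'n \<Rightarrow> real" and b :: "real ^ 'n \<Rightarrow> real ^ 'n"
    and W :: "(real \<times> real) set" and f :: "real \<times> real \<Rightarrow> real"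
  assumes open_X: "open X" and U_X: "\<And>z. z \<in> U \<Longrightarrow> fst z \<in> X"
    and smooth_s: "smooth_on X s" and smooth_b: "smooth_on X b"
    and open_W: "open W" and smooth_f: "smooth_on W f"
    and homogeneous_f: "\<And>w t. w \<in> W \<Longrightarrow> t > 0 \<Longrightarrow> f (t *\<^sub>R w) = t * f w"
    and arg_W: "\<And>z. z \<in> U \<Longrightarrow> f_arg s b L z \<in> W"
    and Lb_eq: "\<And>z. z \<in> U \<Longrightarrow> Lb z = f (f_arg s b L z)"
begin

abbreviation arg where "arg \<equiv> f_arg s b L"
abbreviation sf :: "'n lfun" where "sf \<equiv> \<lambda>z. s (fst z)"
abbreviation bf :: "'n \<Rightarrow> 'n lfun" where "bf i \<equiv> \<lambda>z. b (fst z) $ i"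
abbreviation Lt :: "'n lfun" where "Lt \<equiv> \<lambda>z. exp (s (fst z)) * L z"

lemma smooth_base:
  assumes "smooth_on X h"
  shows "smooth_on U (\<lambda>z. h (fst z))"
  using U_X by (intro smooth_on_compose[OF open_U open_X assms] smooth_on_bounded_linear open_U bounded_linear_fst) auto

lemma vertical_base:
  assumes "smooth_on X h" "z \<in> U"
  shows "\<partial> (0, v) (\<lambda>z. h (fst z)) z = 0"
proof -
  have "((\<lambda>z. h (fst z)) has_derivative (\<lambda>u. \<partial> (fst u) h (fst z))) (at z)"
    using has_derivative_compose[OF has_derivative_fst[OF has_derivative_ident]
        smooth_on_has_derivative[OF assms(1) U_X[OF assms(2)]]] .
  from dir_deriv_eqI[OF this] show ?thesis
    by (simp add: linear_0[OF smooth_on_linear_dir_deriv[OF assms(1) U_X[OF assms(2)]]])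
qed

lemma smooth_b_component: "smooth_on X (\<lambda>x. b x $ i)"
  by (rule smooth_on_linear[OF open_X bounded_linear_vec_nth smooth_b])

lemmas smooth_sf = smooth_base[OF smooth_s]
lemmas smooth_bf = smooth_base[OF smooth_b_component]
lemmas vertical_sf = vertical_base[OF smooth_s]
lemmas vertical_bf = vertical_base[OF smooth_b_component]

lemma smooth_beta: "smooth_on U (beta b)"
  unfolding beta_def
  by (intro smooth_on_sum smooth_on_mult open_U smooth_bf smooth_on_bounded_linear
      bounded_linear_compose[OF bounded_linear_vec_nth bounded_linear_snd])

lemma dir_deriv_beta:
  assumes z: "z \<in> U"
  shows "\<partial> u (beta b) z = (\<Sum>i\<in>UNIV. \<partial> u (bf i) z * snd z $ i) + (\<Sum>i\<in>UNIV. b (fst z) $ i * snd u $ i)"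
proof -
  have "(beta b has_derivative (\<lambda>u. \<Sum>i\<in>UNIV. b (fst z) $ i * snd u $ i + \<partial> u (bf i) z * snd z $ i)) (at z)"
    unfolding beta_def
    by (intro has_derivative_sum has_derivative_mult smooth_on_has_derivative[OF smooth_bf z]
        bounded_linear_imp_has_derivative bounded_linear_compose[OF bounded_linear_vec_nth bounded_linear_snd])
  from dir_deriv_eqI[OF this] show ?thesis by (simp add: sum.distrib)
qed

lemma vertical_beta:
  assumes z: "z \<in> U"
  shows "\<partial> (0, axis i 1) (beta b) z = b (fst z) $ i"
  unfolding dir_deriv_beta[OF z] vertical_bf[OF z]
  by (simp add: axis_def if_distrib cong: if_cong)

lemma smooth_Lt: "smooth_on U Lt"
  by (intro smooth_on_mult smooth_on_exp open_U smooth_sf smooth_L)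

lemma dir_deriv_Lt:
  assumes z: "z \<in> U"
  shows "\<partial> u Lt z = exp (s (fst z)) * (\<partial> u sf z * L z + \<partial> u L z)"
  by (rule dir_deriv_eqI)
    (auto intro!: derivative_eq_intros smooth_on_has_derivative[OF smooth_L z] smooth_on_has_derivative[OF smooth_sf z]
      simp: algebra_simps)

lemma smooth_arg: "smooth_on U arg"
  unfolding f_arg_def[abs_def] by (intro smooth_on_Pair open_U smooth_Lt smooth_beta)

lemma d1_eq: "d1 h = \<partial> (1, 0) h" and d2_eq: "d2 h = \<partial> (0, 1) h"
  by (simp_all add: d1_def[abs_def] d2_def[abs_def] dir_deriv_def)

lemma smooth_d: "smooth_on W h \<Longrightarrow> smooth_on W (d1 h)" "smooth_on W h \<Longrightarrow> smooth_on W (d2 h)"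
  by (simp_all add: d1_eq d2_eq smooth_on_dir_deriv)

lemma smooth_comp_arg: "smooth_on W h \<Longrightarrow> smooth_on U (\<lambda>z. h (arg z))"
  using arg_W by (intro smooth_on_compose[OF open_U open_W _ smooth_arg]) auto

lemma dir_deriv_comp_arg:
  fixes h :: "real \<times> real \<Rightarrow> real"
  assumes h: "smooth_on W h" and z: "z \<in> U"
  shows "\<partial> u (\<lambda>z. h (arg z)) z = d1 h (arg z) * \<partial> u Lt z + d2 h (arg z) * \<partial> u (beta b) z"
proof -
  have "(arg has_derivative (\<lambda>u. (\<partial> u Lt z, \<partial> u (beta b) z))) (at z)"
    unfolding f_arg_def[abs_def]
    by (intro has_derivative_Pair smooth_on_has_derivative[OF smooth_Lt z] smooth_on_has_derivative[OF smooth_beta z])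
  from dir_deriv_eqI[OF has_derivative_compose[OF this smooth_on_has_derivative[OF h arg_W[OF z]]]]
  have "\<partial> u (\<lambda>z. h (arg z)) z = \<partial> (\<partial> u Lt z *\<^sub>R (1, 0) + \<partial> u (beta b) z *\<^sub>R (0, 1)) h (arg z)" by simp
  also have "\<dots> = d1 h (arg z) * \<partial> u Lt z + d2 h (arg z) * \<partial> u (beta b) z"
    unfolding dir_deriv_linear_simps[OF h arg_W[OF z]] by (simp add: d1_eq d2_eq)
  finally show ?thesis .
qed

lemma euler_f:
  assumes w: "w \<in> W"
  shows "\<partial> w f w = f w"
proof (rule euler_homogeneous)
  show "f differentiable (at w)" by (rule smooth_on_differentiable[OF smooth_f w])
  show "f (w + (t - 1) *\<^sub>R w) = t *\<^sub>R f w" if "t > 0" for t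
    using homogeneous_f[OF w that] by (simp add: algebra_simps)
qed

text \<open>Euler's relations for the partial derivatives of \<open>f\<close>, which are homogeneous of degree zero.\<close>

lemma euler_df:
  assumes w: "w \<in> W"
  shows "fst w * d1 (d1 f) w + snd w * d2 (d1 f) w = 0" "fst w * d1 (d2 f) w + snd w * d2 (d2 f) w = 0"
    "d1 (d2 f) w = d2 (d1 f) w"
proof -
  have zero: "\<partial> w (\<partial> u f) w = 0" for u
  proof -
    have "\<partial> u (\<lambda>w. \<partial> w f w) w = \<partial> u f w"
      by (rule dir_deriv_cong[OF open_W w]) (rule euler_f)
    then have "\<partial> u (\<partial> w f) w = 0"
      by (subst (asm) dir_deriv_eqI[OF has_derivative_along_field[OF open_W smooth_f w has_derivative_ident]]) simp
    then show ?thesis by (simp add: dir_deriv_commute[OF open_W smooth_f w, of w])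
  qed
  have expand: "\<partial> w h w = fst w * d1 h w + snd w * d2 h w" if h: "smooth_on W h" for h :: "real \<times> real \<Rightarrow> real"
  proof -
    have "\<partial> w h w = \<partial> (fst w *\<^sub>R (1, 0) + snd w *\<^sub>R (0, 1)) h w" by simp
    then show ?thesis unfolding dir_deriv_linear_simps[OF h w] by (simp add: d1_eq d2_eq)
  qed
  show "fst w * d1 (d1 f) w + snd w * d2 (d1 f) w = 0" "fst w * d1 (d2 f) w + snd w * d2 (d2 f) w = 0"
    using expand[OF smooth_d(1)[OF smooth_f]] expand[OF smooth_d(2)[OF smooth_f]] zero
    by (simp_all only: d1_eq[of f] d2_eq[of f])
  show "d1 (d2 f) w = d2 (d1 f) w"
    unfolding d1_eq d2_eq by (rule dir_deriv_commute[OF open_W smooth_f w])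
qed

lemma sigma_cov_eq: "sigma_cov s i z = \<partial> (axis i 1, 0) sf z"
  by (simp add: sigma_cov_def px_eq)

lemma sigma_0_eq:
  assumes z: "z \<in> U" shows "sigma_0 s z = \<partial> (snd z, 0) sf z"
  unfolding sigma_0_def sigma_cov_eq
  by (rule linear_axis_sum_real(2)[OF smooth_linear_slots(1)[OF open_U smooth_sf z]])

text \<open>The symmetric symbols \<open>\<Gamma>\<close> drop out of \<open>F\<^sub>i\<^sub>j\<close>, which leaves the exterior derivative of the 1-form.\<close>

lemma F_0_eq:
  assumes z: "z \<in> U"
  shows "F_0 b L i z = 1/2 * (\<partial> (axis i 1, 0) (beta b) z - \<partial> (snd z, 0) (bf i) z)"
proof -
  have "F_cov b L l i z = 1/2 * (\<partial> (axis i 1, 0) (bf l) z - \<partial> (axis l 1, 0) (bf i) z)" for l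
    unfolding F_cov_def b_cov_def px_eq cartan_christoffel_sym[OF z, of _ l i] by simp
  then have "F_0 b L i z = 1/2 * ((\<Sum>l\<in>UNIV. \<partial> (axis i 1, 0) (bf l) z * snd z $ l) - (\<Sum>l\<in>UNIV. \<partial> (axis l 1, 0) (bf i) z * snd z $ l))"
    by (simp add: F_0_def sum_distrib_left sum_subtractf left_diff_distrib right_diff_distrib mult_ac)
  then show ?thesis
    unfolding linear_axis_sum_real(2)[OF smooth_linear_slots(1)[OF open_U smooth_bf z]] dir_deriv_beta[OF z] by simp
qed

text \<open>As \<open>\<Gamma>\<^sup>m\<^sub>i\<^sub>j y\<^sup>i y\<^sup>j = 2 G\<^sup>m\<close>, the covariant derivative contracted with \<open>y\<close> twice is \<open>S \<beta>\<close>.\<close>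

lemma E_00_eq:
  assumes z: "z \<in> U"
  shows "E_00 b L z = \<partial> (spray_field G z) (beta b) z"
proof -
  let ?y = "snd z"
  have "E_00 b L z = 1/2 * ((\<Sum>i\<in>UNIV. \<Sum>j\<in>UNIV. b_cov b L i j z * ?y $ i * ?y $ j) + (\<Sum>i\<in>UNIV. \<Sum>j\<in>UNIV. b_cov b L j i z * ?y $ i * ?y $ j))"
    by (simp add: E_00_def E_cov_def sum_distrib_left sum.distrib ring_distribs mult_ac)
  also have "(\<Sum>i\<in>UNIV. \<Sum>j\<in>UNIV. b_cov b L j i z * ?y $ i * ?y $ j) = (\<Sum>i\<in>UNIV. \<Sum>j\<in>UNIV. b_cov b L i j z * ?y $ i * ?y $ j)"
    by (subst sum.swap) (simp add: mult_ac)
  also have "1/2 * (r + r) = r" for r :: real by simp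
  also have "(\<Sum>i\<in>UNIV. \<Sum>j\<in>UNIV. b_cov b L i j z * ?y $ i * ?y $ j) =
      (\<Sum>i\<in>UNIV. (\<Sum>j\<in>UNIV. \<partial> (axis j 1, 0) (bf i) z * ?y $ j) * ?y $ i)
      - (\<Sum>i\<in>UNIV. \<Sum>j\<in>UNIV. \<Sum>m\<in>UNIV. b (fst z) $ m * (cartan_christoffel L m i j z * ?y $ i * ?y $ j))"
    by (simp add: b_cov_def px_eq sum_distrib_left sum_distrib_right sum_subtractf left_diff_distrib right_diff_distrib mult_ac)
  also have "(\<Sum>i\<in>UNIV. \<Sum>j\<in>UNIV. \<Sum>m\<in>UNIV. b (fst z) $ m * (cartan_christoffel L m i j z * ?y $ i * ?y $ j)) =
      (\<Sum>m\<in>UNIV. \<Sum>i\<in>UNIV. \<Sum>j\<in>UNIV. b (fst z) $ m * (cartan_christoffel L m i j z * ?y $ i * ?y $ j))"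
    by (subst sum.swap[of _ _ "UNIV :: 'n set", symmetric]) (subst (2) sum.swap, simp)
  also have "\<dots> = (\<Sum>m\<in>UNIV. b (fst z) $ m * (2 * G z $ m))"
    unfolding sum_distrib_left[symmetric] cartan_christoffel_y_y[OF z] ..
  also have "(\<Sum>i\<in>UNIV. (\<Sum>j\<in>UNIV. \<partial> (axis j 1, 0) (bf i) z * ?y $ j) * ?y $ i) = (\<Sum>i\<in>UNIV. \<partial> (spray_field G z) (bf i) z * ?y $ i)"
    unfolding linear_axis_sum_real(2)[OF smooth_linear_slots(1)[OF open_U smooth_bf z]]
      spray_field_def dir_deriv_Pair_simps(1)[OF smooth_bf z, of ?y "_ *\<^sub>R _"] vertical_bf[OF z] by simp
  finally show ?thesis
    unfolding dir_deriv_beta[OF z] by (simp add: spray_field_def sum_negf mult_ac)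
qed

lemma L_constant_along_spray:
  assumes z: "z \<in> U"
  shows "\<partial> (spray_field G z) L z = 0"
  using energy_constant_along_spray[OF z] pos_L[OF z] by (simp add: dir_deriv_E[OF z])

lemma L_euler_lagrange:
  assumes z: "z \<in> U"
  shows "\<partial> (spray_field G z) (\<partial> (0, v) L) z = \<partial> (v, 0) L z"
  using spray_euler_lagrange[OF z, of v] pos_L[OF z]
  unfolding dir_deriv2_energy[OF z] dir_deriv_E[OF z] L_constant_along_spray[OF z] by simp

lemma y_low_supp: "z \<in> U \<Longrightarrow> y_low L i z = L z * \<partial> (0, axis i 1) L z"
  by (simp add: y_low_eq fund_form_y dir_deriv_E)

text \<open>With \<open>S L = 0\<close> and \<open>S \<beta> = E\<^sub>0\<^sub>0\<close>, the chain rule expresses the left side by the second derivatives of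
  \<open>f\<close>; Euler's relations reduce these to \<open>f\<^sub>2\<^sub>2\<close>, and the combination \<open>b\<^sub>i - (\<beta>/L) l\<^sub>i = m\<^sub>i\<close> appears.\<close>

lemma euler_lagrange_defect:
  assumes z: "z \<in> U"
  shows "Lb z * (\<partial> (spray_field G z) (\<partial> (0, axis i 1) Lb) z - \<partial> (axis i 1, 0) Lb z) = - phi f s b L i z"
proof -
  let ?S = "spray_field G z" and ?e = "axis i 1 :: real ^ 'n"
  define a1 a2 a11 a12 a22 where a: "a1 = d1 f (arg z)" "a2 = d2 f (arg z)" "a11 = d1 (d1 f) (arg z)"
    "a12 = d2 (d1 f) (arg z)" "a22 = d2 (d2 f) (arg z)"
  define \<epsilon> l where el: "\<epsilon> = exp (s (fst z))" "l = \<partial> (0, ?e) L z"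
  have \<epsilon>: "\<epsilon> \<noteq> 0" and L: "L z \<noteq> 0" using pos_L[OF z] by (simp_all add: el)
  have f1: "smooth_on W (d1 f)" and f2: "smooth_on W (d2 f)" using smooth_d smooth_f by auto
  have Ssf: "\<partial> ?S sf z = sigma_0 s z"
    unfolding sigma_0_eq[OF z] spray_field_def
    by (subst dir_deriv_Pair_simps(1)[OF smooth_sf z]) (simp add: vertical_sf[OF z])
  have Sbf: "\<partial> ?S (bf i) z = \<partial> (snd z, 0) (bf i) z"
    unfolding spray_field_def
    by (subst dir_deriv_Pair_simps(1)[OF smooth_bf z]) (simp add: vertical_bf[OF z])
  have SLt: "\<partial> ?S Lt z = \<epsilon> * sigma_0 s z * L z"
    by (simp add: dir_deriv_Lt[OF z] Ssf L_constant_along_spray[OF z] el)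
  have Sbeta: "\<partial> ?S (beta b) z = E_00 b L z" by (simp add: E_00_eq[OF z])
  have S1: "\<partial> ?S (\<lambda>w. d1 f (arg w)) z = a11 * (\<epsilon> * sigma_0 s z * L z) + a12 * E_00 b L z"
    unfolding dir_deriv_comp_arg[OF f1 z] SLt Sbeta a ..
  have S2: "\<partial> ?S (\<lambda>w. d2 f (arg w)) z = a12 * (\<epsilon> * sigma_0 s z * L z) + a22 * E_00 b L z"
    unfolding dir_deriv_comp_arg[OF f2 z] SLt Sbeta a euler_df(3)[OF arg_W[OF z]] ..
  have dLb: "\<partial> u Lb w = d1 f (arg w) * \<partial> u Lt w + d2 f (arg w) * \<partial> u (beta b) w" if w: "w \<in> U" for u w
    using dir_deriv_comp_arg[OF smooth_f w, of u] dir_deriv_cong[OF open_U w Lb_eq, where v = u] by simp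
  have vLb: "\<partial> (0, ?e) Lb w = d1 f (arg w) * (exp (s (fst w)) * \<partial> (0, ?e) L w) + d2 f (arg w) * b (fst w) $ i"
    if w: "w \<in> U" for w
    by (simp add: dLb[OF w] dir_deriv_Lt[OF w] vertical_beta[OF w] vertical_sf[OF w])
  have hLb: "\<partial> (?e, 0) Lb z = a1 * \<epsilon> * (sigma_cov s i z * L z + \<partial> (?e, 0) L z) + a2 * \<partial> (?e, 0) (beta b) z"
    by (simp add: dLb[OF z] dir_deriv_Lt[OF z] sigma_cov_eq a el)
  have "\<partial> ?S (\<partial> (0, ?e) Lb) z = \<partial> ?S (\<lambda>w. d1 f (arg w) * (exp (s (fst w)) * \<partial> (0, ?e) L w) + d2 f (arg w) * b (fst w) $ i) z"
    by (rule dir_deriv_cong[OF open_U z]) (rule vLb)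
  also have "\<dots> = \<partial> ?S (\<lambda>w. d1 f (arg w)) z * (\<epsilon> * l)
      + a1 * (\<epsilon> * \<partial> ?S sf z * l + \<epsilon> * \<partial> ?S (\<partial> (0, ?e) L) z)
      + \<partial> ?S (\<lambda>w. d2 f (arg w)) z * b (fst z) $ i + a2 * \<partial> ?S (bf i) z"
    unfolding a el
    by (rule dir_deriv_eqI)
      (auto intro!: derivative_eq_intros smooth_on_has_derivative[OF smooth_comp_arg[OF f1] z]
        smooth_on_has_derivative[OF smooth_comp_arg[OF f2] z] smooth_on_has_derivative[OF smooth_sf z]
        smooth_on_has_derivative[OF smooth_on_dir_deriv[OF smooth_L] z]
        smooth_on_has_derivative[OF smooth_bf z] simp: algebra_simps)
  finally have vert: "\<partial> ?S (\<partial> (0, ?e) Lb) z = (a11 * (\<epsilon> * sigma_0 s z * L z) + a12 * E_00 b L z) * (\<epsilon> * l)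
      + a1 * (\<epsilon> * sigma_0 s z * l + \<epsilon> * \<partial> (?e, 0) L z)
      + (a12 * (\<epsilon> * sigma_0 s z * L z) + a22 * E_00 b L z) * b (fst z) $ i + a2 * \<partial> (snd z, 0) (bf i) z"
    unfolding S1 S2 Ssf Sbf L_euler_lagrange[OF z] .
  \<comment> \<open>Euler's relations for \<open>f\<close> eliminate all second derivatives but \<open>f\<^sub>2\<^sub>2\<close>\<close>
  have hom: "a12 = - beta b z * a22 / (\<epsilon> * L z)" "a11 = (beta b z)\<^sup>2 * a22 / (\<epsilon> * L z)\<^sup>2"
  proof -
    have "\<epsilon> * L z * a12 + beta b z * a22 = 0" "\<epsilon> * L z * a11 + beta b z * a12 = 0"
      using euler_df[OF arg_W[OF z]] by (simp_all add: a el f_arg_def)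
    then show "a12 = - beta b z * a22 / (\<epsilon> * L z)" "a11 = (beta b z)\<^sup>2 * a22 / (\<epsilon> * L z)\<^sup>2"
      using \<epsilon> L by (simp_all add: field_simps power2_eq_square) algebra+
  qed
  have phi: "phi f s b L i z = (L z)\<^sup>2 * \<epsilon> * (Lb z * a1 / L z) * sigma_cov s i z
     - ((Lb z * a1 / L z) * L z * \<epsilon> * l - (Lb z * a22) * beta b z * (b (fst z) $ i - beta b z / (L z)\<^sup>2 * (L z * l))) * sigma_0 s z
     + 2 * (Lb z * a2) * (1/2 * (\<partial> (?e, 0) (beta b) z - \<partial> (snd z, 0) (bf i) z))
     - (Lb z * a22) * E_00 b L z * (b (fst z) $ i - beta b z / (L z)\<^sup>2 * (L z * l))"
    unfolding phi_def p_coef_def q_coef_def q0_coef_def m_cov_def supp_def py_eq F_0_eq[OF z] y_low_supp[OF z]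
      Lb_eq[OF z, symmetric] a el ..
  show ?thesis
    unfolding vert hLb phi hom using \<epsilon> L by (simp add: field_simps power2_eq_square)
qed

context
  assumes phi_0: "\<And>z i. z \<in> U \<Longrightarrow> phi f s b L i z = 0"
begin

definition proj_factor :: "'n lfun" where
  "proj_factor z = \<partial> (spray_field G z) Lb z / (2 * Lb z)"

text \<open>Rapcsak's criterion.\<close>

lemma change_euler_lagrange:
  assumes z: "z \<in> U"
  shows "\<partial> (spray_field G z) (\<partial> (0, v) Lb) z = \<partial> (v, 0) Lb z"
proof -
  have axis: "\<partial> (spray_field G z) (\<partial> (0, axis i 1) Lb) z = \<partial> (axis i 1, 0) Lb z" for i
    using euler_lagrange_defect[OF z, of i] phi_0[OF z, of i] bar.pos_L[OF z] by simp
  show ?thesis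
    using linear_axis_sum_real(1)[OF smooth_linear_slots(4)[OF open_U bar.smooth_L z], of v "spray_field G z"]
      linear_axis_sum_real(1)[OF smooth_linear_slots(1)[OF open_U bar.smooth_L z], of v]
    by (simp add: axis)
qed

text \<open>For the energy of \<open>Lb\<close>, the spray \<open>S\<close> violates the Euler-Lagrange equations by \<open>2 (S Lb) \<partial>Lb/\<partial>y\<^sup>i\<close>,
  which is exactly the effect of adding a multiple of \<open>y\<close> to the spray.  Nondegeneracy of the metric
  of \<open>Lb\<close> shows that the two sprays differ by nothing else.\<close>

lemma spray_projective:
  assumes z: "z \<in> U"
  shows "bar.G z = G z + proj_factor z *\<^sub>R snd z"
proof -
  let ?S = "spray_field G z" and ?d = "2 *\<^sub>R (bar.G z - G z - proj_factor z *\<^sub>R snd z)"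
  have "fund_form Lb z ?d v = 0" for v
  proof -
    let ?F = "\<partial> (0, v) bar.E"
    have S: "?S = spray_field bar.G z + (0, ?d) + (2 * proj_factor z) *\<^sub>R (0, snd z)"
      by (simp add: spray_field_def algebra_simps)
    have "\<partial> ?S ?F z = \<partial> (v, 0) bar.E z + \<partial> (0, ?d) ?F z + 2 * proj_factor z * \<partial> (0, v) bar.E z"
      unfolding S dir_deriv_linear_simps[OF bar.smooth_dE z] bar.spray_euler_lagrange[OF z] bar.euler_vert_E[OF z] by simp
    moreover have "\<partial> ?S ?F z = \<partial> (v, 0) bar.E z + 2 * \<partial> ?S Lb z * \<partial> (0, v) Lb z"
      unfolding bar.dir_deriv2_energy[OF z] change_euler_lagrange[OF z] bar.dir_deriv_E[OF z] by (simp add: algebra_simps)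
    moreover have "2 * proj_factor z * \<partial> (0, v) bar.E z = 2 * \<partial> ?S Lb z * \<partial> (0, v) Lb z"
      using bar.pos_L[OF z] by (simp add: bar.dir_deriv_E[OF z] proj_factor_def)
    ultimately show ?thesis by (simp add: fund_form_def)
  qed
  then have "?d = 0"
    using bar.fund_form_nondegenerate[OF z, of ?d] bar.fund_form_sym[OF z, of ?d] by simp
  then have "bar.G z - G z - proj_factor z *\<^sub>R snd z = 0" by (simp only: scaleR_eq_0_iff) simp
  then show ?thesis by (simp add: algebra_simps)
qed

lemma smooth_proj_factor: "smooth_on U proj_factor"
proof -
  have "smooth_on U (spray_field G)"
    unfolding spray_field_def[abs_def]
    by (intro smooth_on_Pair open_U smooth_on_bounded_linear bounded_linear_snd
        smooth_on_linear[OF open_U bounded_linear_scaleR_right] smooth_spray)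
  then show ?thesis
    unfolding proj_factor_def[abs_def]
    using bar.pos_L
    by (intro smooth_on_divide smooth_on_along_field smooth_on_linear[OF open_U bounded_linear_mult_right] open_U bar.smooth_L)
      force+
qed

text \<open>Both sprays have degree two, hence so does \<open>P y\<close>, and \<open>y \<noteq> 0\<close>.\<close>

lemma euler_proj_factor:
  assumes z: "z \<in> U"
  shows "\<partial> (0, snd z) proj_factor z = proj_factor z"
proof -
  let ?P = proj_factor and ?y = "snd z"
  have "((\<lambda>w. G w + ?P w *\<^sub>R snd w) has_derivative
      (\<lambda>u. \<partial> u G z + (?P z *\<^sub>R snd u + \<partial> u ?P z *\<^sub>R ?y))) (at z)"
    by (intro has_derivative_add has_derivative_scaleR has_derivative_snd has_derivative_ident
        smooth_on_has_derivative[OF smooth_spray z] smooth_on_has_derivative[OF smooth_proj_factor z])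
  from dir_deriv_eqI[OF this, of "(0, ?y)"]
  have "\<partial> (0, ?y) bar.G z = \<partial> (0, ?y) G z + (?P z *\<^sub>R ?y + \<partial> (0, ?y) ?P z *\<^sub>R ?y)"
    using dir_deriv_cong[OF open_U z spray_projective, where v = "(0, ?y)"] by simp
  then have "2 *\<^sub>R G z + (?P z *\<^sub>R ?y + \<partial> (0, ?y) ?P z *\<^sub>R ?y) - 2 *\<^sub>R (G z + ?P z *\<^sub>R ?y) = 0"
    unfolding euler_spray[OF z] bar.euler_spray[OF z] spray_projective[OF z] by simp
  also have "2 *\<^sub>R G z + (?P z *\<^sub>R ?y + \<partial> (0, ?y) ?P z *\<^sub>R ?y) - 2 *\<^sub>R (G z + ?P z *\<^sub>R ?y) =
      (\<partial> (0, ?y) ?P z - ?P z) *\<^sub>R ?y"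
    unfolding scaleR_2 scaleR_left_diff_distrib by simp
  finally have "(\<partial> (0, ?y) ?P z - ?P z) *\<^sub>R ?y = 0" .
  moreover have "?y \<noteq> 0"
    using euler_L[OF z] pos_L[OF z] by (auto simp: linear_0[OF smooth_linear_slots(2)[OF open_U smooth_L z]])
  ultimately show ?thesis by simp
qed

lemma jacobi_endo_scalar_form_iff:
  assumes z: "z \<in> U"
  shows "(\<exists>c \<omega>. \<forall>v. jacobi_endo bar.G v z = c *\<^sub>R v + \<omega> v *\<^sub>R snd z) \<longleftrightarrow>
    (\<exists>c \<omega>. \<forall>v. jacobi_endo G v z = c *\<^sub>R v + \<omega> v *\<^sub>R snd z)"
proof -
  obtain c \<omega> where J: "\<And>v. jacobi_endo bar.G v z = jacobi_endo G v z + c *\<^sub>R v + \<omega> v *\<^sub>R snd z"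
    using jacobi_endo_projective[OF spray_on_axioms smooth_proj_factor euler_proj_factor spray_projective z] by blast
  show ?thesis
  proof
    assume "\<exists>c \<omega>. \<forall>v. jacobi_endo bar.G v z = c *\<^sub>R v + \<omega> v *\<^sub>R snd z"
    then obtain c' \<omega>' where "\<And>v. jacobi_endo bar.G v z = c' *\<^sub>R v + \<omega>' v *\<^sub>R snd z" by blast
    then have "jacobi_endo G v z = (c' - c) *\<^sub>R v + (\<omega>' v - \<omega> v) *\<^sub>R snd z" for v
      using J[of v] by (simp add: algebra_simps)
    then show "\<exists>c \<omega>. \<forall>v. jacobi_endo G v z = c *\<^sub>R v + \<omega> v *\<^sub>R snd z"
      by (intro exI[of _ "c' - c"] exI[of _ "\<lambda>v. \<omega>' v - \<omega> v"]) blast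
  next
    assume "\<exists>c \<omega>. \<forall>v. jacobi_endo G v z = c *\<^sub>R v + \<omega> v *\<^sub>R snd z"
    then obtain c' \<omega>' where "\<And>v. jacobi_endo G v z = c' *\<^sub>R v + \<omega>' v *\<^sub>R snd z" by blast
    then have "jacobi_endo bar.G v z = (c' + c) *\<^sub>R v + (\<omega>' v + \<omega> v) *\<^sub>R snd z" for v
      using J[of v] by (simp add: algebra_simps)
    then show "\<exists>c \<omega>. \<forall>v. jacobi_endo bar.G v z = c *\<^sub>R v + \<omega> v *\<^sub>R snd z"
      by (intro exI[of _ "c' + c"] exI[of _ "\<lambda>v. \<omega>' v + \<omega> v"]) blast
  qed
qed

end

end

section \<open>Passage from charts to the manifold\<close>

text \<open>The differentials of the transition maps are linear, so scaling commutes with the change of chart.\<close>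

lemma tvec_of_scale:
  assumes M: "smooth_manifold M A" and c: "c \<in> A" and x: "x \<in> chart_image c"
  shows "tvec_of A c (x, t *\<^sub>R y) = tscale t (tvec_of A c (x, y))"
proof -
  have p: "chart_inv c x \<in> fst c" "snd c (chart_inv c x) = x"
    using x unfolding chart_image_def chart_inv_def by (auto intro: inv_into_into f_inv_into_f)
  have "frechet_derivative (transition c d) (at x) (t *\<^sub>R y) = t *\<^sub>R frechet_derivative (transition c d) (at x) y"
    if d: "d \<in> A" "chart_inv c x \<in> fst d" for d
  proof -
    have "smooth_on (snd c ` (fst c \<inter> fst d)) (transition c d)"
      using M c d(1) by (simp add: smooth_manifold_def)
    moreover have "x \<in> snd c ` (fst c \<inter> fst d)" using p d(2) by force
    ultimately have "linear (frechet_derivative (transition c d) (at x))"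
      by (intro linear_frechet_derivative) (rule smooth_on_differentiable)
    then show ?thesis by (rule linear_scale)
  qed
  then show ?thesis by (auto simp: tvec_of_def tscale_def fun_eq_iff)
qed

text \<open>Scaling may leave \<open>D\<close> but not the cone \<open>T\<close>, so Euler's relation is derived from homogeneity on \<open>T\<close>.\<close>

lemma finsler_chart_loc_fun:
  assumes M: "smooth_manifold M A" and T: "conic_domain M A T" and F: "finsler A T F"
    and D: "D \<subseteq> T" "open_in_tangent_bundle A D" and c: "c \<in> A"
  shows "finsler_chart (loc_set A c D) (loc_fun A c F)"
proof -
  let ?F = "loc_fun A c F"
  have sub: "loc_set A c D \<subseteq> loc_set A c T" using D(1) by (auto simp: loc_set_def)
  have smooth: "smooth_on (loc_set A c T) ?F" using F c by (simp add: finsler_def)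
  show ?thesis
  proof
    show "open (loc_set A c D)" using D(2) c by (simp add: open_in_tangent_bundle_def)
    show "smooth_on (loc_set A c D) ?F" using smooth sub by (rule smooth_on_subset)
    show "?F z > 0" if "z \<in> loc_set A c D" for z
      using that sub F by (auto simp: finsler_def loc_set_def loc_fun_def)
    show "invertible (metric ?F z)" if "z \<in> loc_set A c D" for z
      using that sub F c unfolding finsler_def by blast
    show "\<partial> (0, snd z) ?F z = ?F z" if z: "z \<in> loc_set A c D" for z
    proof (rule euler_homogeneous)
      show "?F differentiable (at z)" using smooth sub z by (auto intro: smooth_on_differentiable)
      show "?F (z + (t - 1) *\<^sub>R (0, snd z)) = t *\<^sub>R ?F z" if t: "t > 0" for t
      proof -
        have x: "fst z \<in> chart_image c" and w: "tvec_of A c z \<in> T" using z sub by (auto simp: loc_set_def)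
        have "z + (t - 1) *\<^sub>R (0, snd z) = (fst z, t *\<^sub>R snd z)" by (simp add: prod_eq_iff algebra_simps)
        then have "tvec_of A c (z + (t - 1) *\<^sub>R (0, snd z)) = tscale t (tvec_of A c z)"
          using tvec_of_scale[OF M c x, of t "snd z"] by simp
        then show ?thesis using F w t by (simp add: finsler_def loc_fun_def)
      qed
    qed
  qed
qed

theorem theorem5p7:
  fixes M :: "'m topology"
    and A :: "('m, 'n::finite) chart set"
    and T D :: "('m, 'n) tvec set"
    and L \<beta> :: "('m, 'n) tvec \<Rightarrow> real"
    and \<sigma> :: "'m \<Rightarrow> real"
    and f :: "real \<times> real \<Rightarrow> real"
    and W :: "(real \<times> real) set"
  assumes "smooth_manifold M A"
    and "conic_domain M A T"
    and "finsler A T L"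
    and "generalized_beta_conformal A T W f \<sigma> \<beta> L"
    and "D \<subseteq> T"
    and "open_in_tangent_bundle A D"
    and "\<forall>c\<in>A. \<forall>z\<in>loc_set A c D.
           standing_assumptions f (loc_scalar c \<sigma>) (loc_form A c \<beta>) (loc_fun A c L) z"
    and "\<forall>c\<in>A. \<forall>z\<in>loc_set A c D. \<forall>i.
           phi f (loc_scalar c \<sigma>) (loc_form A c \<beta>) (loc_fun A c L) i z = 0"
  shows "scalar_curvature A D (change f \<sigma> \<beta> L) \<longleftrightarrow> scalar_curvature A D L"
proof -
  note gbc = assms(4)[unfolded generalized_beta_conformal_def]
  have local: "(\<forall>V V'. flag_denom (loc_fun A c (change f \<sigma> \<beta> L)) z V \<noteq> 0 \<longrightarrow> flag_denom (loc_fun A c (change f \<sigma> \<beta> L)) z V' \<noteq> 0 \<longrightarrow>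
        flag_curvature (loc_fun A c (change f \<sigma> \<beta> L)) z V = flag_curvature (loc_fun A c (change f \<sigma> \<beta> L)) z V') \<longleftrightarrow>
      (\<forall>V V'. flag_denom (loc_fun A c L) z V \<noteq> 0 \<longrightarrow> flag_denom (loc_fun A c L) z V' \<noteq> 0 \<longrightarrow>
        flag_curvature (loc_fun A c L) z V = flag_curvature (loc_fun A c L) z V')"
    if c: "c \<in> A" and z: "z \<in> loc_set A c D" for c z
  proof -
    let ?U = "loc_set A c D" and ?s = "loc_scalar c \<sigma>" and ?b = "loc_form A c \<beta>"
    have base: "fst z \<in> chart_image c" and tangent: "tvec_of A c z \<in> T" if "z \<in> ?U" for z
      using that assms(5) by (auto simp: loc_set_def)
    have arg: "(exp (\<sigma> (fst (tvec_of A c z))) * L (tvec_of A c z), \<beta> (tvec_of A c z)) = f_arg ?s ?b (loc_fun A c L) z"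
      if "z \<in> ?U" for z
    proof -
      have "\<beta> (tvec_of A c (fst z, snd z)) = beta ?b z"
        using gbc c base[OF that] unfolding smooth_one_form_def beta_def by blast
      then show ?thesis by (simp add: f_arg_def loc_scalar_def loc_fun_def tvec_of_def)
    qed
    interpret finsler_chart ?U "loc_fun A c L"
      by (rule finsler_chart_loc_fun[OF assms(1,2,3,5,6) c])
    interpret bar: finsler_chart ?U "loc_fun A c (change f \<sigma> \<beta> L)"
      using gbc by (intro finsler_chart_loc_fun[OF assms(1,2) _ assms(5,6) c]) blast
    interpret beta_change ?U "loc_fun A c L" "loc_fun A c (change f \<sigma> \<beta> L)" "chart_image c" ?s ?b W f
    proof
      show "open (chart_image c)" using assms(1) c by (simp add: smooth_manifold_def chart_of_def)
      show "smooth_on (chart_image c) ?s" using gbc c by (simp add: smooth_scalar_def loc_scalar_def)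
      show "smooth_on (chart_image c) ?b" using gbc c by (simp add: smooth_one_form_def)
      show "open W" "smooth_on W f" using gbc by auto
      show "f (t *\<^sub>R w) = t * f w" if "w \<in> W" "t > 0" for w t
        using gbc that by (cases w; simp)+
      show "f_arg ?s ?b (loc_fun A c L) z \<in> W" if "z \<in> ?U" for z
        using gbc tangent[OF that] arg[OF that] by metis
      show "loc_fun A c (change f \<sigma> \<beta> L) z = f (f_arg ?s ?b (loc_fun A c L) z)" if "z \<in> ?U" for z
        using arg[OF that] by (simp add: loc_fun_def change_def)
    qed (rule base)
    show ?thesis
      unfolding flag_curvature_independent_iff[OF z] bar.flag_curvature_independent_iff[OF z]
      by (rule jacobi_endo_scalar_form_iff[OF _ z]) (use assms(8) c in blast)
  qed
  then show ?thesis unfolding scalar_curvature_def by blast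
qed

end
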